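(* Let $\mathbf{s}_j=(x'_j,y'_j)$, $j=1,\dots,N_S$, and $\mathbf{t}_l=(x_l,y_l)$, $l=1,\dots,N_T$, be sources and targets in the unit cell $\mathcal{C}$, and let $\mathbf{q}=(q_1,\dots,q_{N_S})\in\mathbb{R}^{N_S}$ be charge strengths with $\sum_{j=1}^{N_S}q_j=0$. Given a precision $0<\epsilon<1$, let $$M=\left\lceil\frac{d}{2\pi\eta}\log\left(\frac{1}{1-e^{-2\pi\eta/d}}\,\frac1\epsilon\right)\right\rceil ,$$ and for $m=-M,\dots,M$ let $\alpha_m=\frac{2\pi m}{d}$ and $Q_m=|\alpha_m|\eta-i\alpha_m\xi$. Let $\mathbf{L}^{north}\in\mathbb{C}^{N_T\times(2M+1)}$ and $\mathbf{R}^{north}\in\mathbb{C}^{(2M+1)\times N_S}$ be given by $$\mathbf{L}^{north}(l,m)=e^{|\alpha_m|y_l}e^{i\alpha_m x_l}\ (m\ne0),\qquad \mathbf{L}^{north}(l,0)=y_l,$$ $$\mathbf{R}^{north}(m,j)=e^{-|\alpha_m|y'_j}e^{-i\alpha_m x'_j}\ (m\ne0),\qquad \mathbf{R}^{north}(0,j)=y'_j,$$ and let $\mathbf{D}^{north}=\overline{\mathbf{D}^{south}}$, where $\mathbf{D}^{south}$ is diagonal with $$\mathbf{D}^{south}(m,m)=\frac{1}{4\pi|m|}\frac{e^{-2Q_m}}{1-e^{-Q_m}}\ (m\ne0),\qquad \mathbf{D}^{south}(0,0)=-\frac{1}{2d\eta}.$$ Then, for the Poisson equation, $$\mathbf{P}_2^{north}\,\mathbf{q}=\mathbf{L}^{north}\,\mathbf{D}^{north}\,\mathbf{R}^{north}\,\mathbf{q}+O(\epsilon)\quad\text{up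 to an additive constant},$$ that is, for all $l,l'\in\{1,\dots,N_T\}$ the limit $$\Delta_{l,l'}=\lim_{\beta\to0^+}\sum_{j=1}^{N_S}\left(K_{2,\beta}^{north}(\mathbf{t}_l,\mathbf{s}_j)-K_{2,\beta}^{north}(\mathbf{t}_{l'},\mathbf{s}_j)\right)q_j$$ exists and $$\left|\Delta_{l,l'}-\left[\left(\mathbf{L}^{north}\mathbf{D}^{north}\mathbf{R}^{north}\mathbf{q}\right)_l-\left(\mathbf{L}^{north}\mathbf{D}^{north}\mathbf{R}^{north}\mathbf{q}\right)_{l'}\right]\right|\le C\,\epsilon\sum_{j=1}^{N_S}|q_j| ,$$ with $C$ independent of $\epsilon$, $\mathbf{q}$ and the number and locations of the sources and targets.
   Context: Let $d,\eta>0$ and $\xi\in\mathbb{R}$ with $d\ge\sqrt{\xi^2+\eta^2}$, $\mathbf{e}_1=(d,0)$, $\mathbf{e}_2=(\xi,\eta)$, $\mathcal{C}=\{x_1\mathbf{e}_1+x_2\mathbf{e}_2 : x_1,x_2\in[-\tfrac12,\tfrac12]\}$, $\mathbf{l}_{mn}=m\mathbf{e}_1+n\mathbf{e}_2$. For $\beta>0$, $$K_{2,\beta}^{north}(\mathbf{t},\mathbf{s})=\sum_{n=2}^{\infty}\sum_{m=-\infty}^{\infty}\frac{1}{2\pi}K_0(\beta\|\mathbf{t}-\mathbf{s}-\mathbf{l}_{mn}\|)$$ is the modified Helmholtz kernel for the "north" image sources ($K_0$ the modified Bessel function of the second kind). For the Poisson equation, the potential $\mathbf{P}_2^{north}\mathbf{q}$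 due to the north image sources is defined, for charge-neutral $\mathbf{q}$ and up to an arbitrary additive constant, as the limit $\beta\to0$ of the modified Helmholtz one. The bar denotes complex conjugation. Rows/columns indexed by $m$ run over $-M,\dots,M$. The constant $C$ may depend on $d,\xi,\eta$. *)

theory Defs
  imports "HOL-Analysis.Analysis"
begin

text \<open>
  The modified Bessel function of the second kind of real order \<open>\<nu>\<close>, for \<open>x > 0\<close>, by its
  standard integral formula (Watson, Treatise on the Theory of Bessel Functions, 6.22;
  DLMF 10.32.9). For \<open>x \<le> 0\<close> the integral diverges and the value is meaningless.
\<close>
definition bessel_K :: "real \<Rightarrow> real \<Rightarrow> real" where
  "bessel_K \<nu> x = (LINT t:{0..}|lborel. exp (- x * cosh t) * cosh (\<nu> * t))"

text \<open>The norm on \<^typ>\<open>real \<times> real\<close> is the Euclidean one.\<close>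

definition e1 :: "real \<Rightarrow> real \<times> real" where
  "e1 d = (d, 0)"

definition e2 :: "real \<Rightarrow> real \<Rightarrow> real \<times> real" where
  "e2 \<xi> \<eta> = (\<xi>, \<eta>)"

definition unit_cell :: "real \<Rightarrow> real \<Rightarrow> real \<Rightarrow> (real \<times> real) set" where
  "unit_cell d \<xi> \<eta> =
     {x1 *\<^sub>R e1 d + x2 *\<^sub>R e2 \<xi> \<eta> | x1 x2. x1 \<in> {-1/2..1/2} \<and> x2 \<in> {-1/2..1/2}}"

definition lattice_point :: "real \<Rightarrow> real \<Rightarrow> real \<Rightarrow> int \<Rightarrow> int \<Rightarrow> real \<times> real" where
  "lattice_point d \<xi> \<eta> m n = of_int m *\<^sub>R e1 d + of_int n *\<^sub>R e2 \<xi> \<eta>"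

definition K2_north ::
  "real \<Rightarrow> real \<Rightarrow> real \<Rightarrow> real \<Rightarrow> real \<times> real \<Rightarrow> real \<times> real \<Rightarrow> real" where
  "K2_north d \<xi> \<eta> \<beta> t s =
     (\<Sum>\<^sub>\<infinity>n\<in>{2::int..}. \<Sum>\<^sub>\<infinity>m\<in>(UNIV::int set).
        1 / (2 * pi) * bessel_K 0 (\<beta> * norm (t - s - lattice_point d \<xi> \<eta> m n)))"

definition alpha :: "real \<Rightarrow> int \<Rightarrow> real" where
  "alpha d m = 2 * pi * of_int m / d"

definition Q :: "real \<Rightarrow> real \<Rightarrow> real \<Rightarrow> int \<Rightarrow> complex" where
  "Q d \<xi> \<eta> m = of_real (\<bar>alpha d m\<bar> * \<eta>) - \<i> * of_real (alpha d m * \<xi>)"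

definition truncation :: "real \<Rightarrow> real \<Rightarrow> real \<Rightarrow> int" where
  "truncation d \<eta> \<epsilon> =
     \<lceil>d / (2 * pi * \<eta>) * ln (1 / (1 - exp (- 2 * pi * \<eta> / d)) * (1 / \<epsilon>))\<rceil>"

text \<open>
  Matrices are functions of a row and a column index, the index ranges being supplied where
  they are multiplied: points are indexed by \<open>{1..N}\<close> and Fourier modes by \<open>{-M..M}\<close>.
\<close>
definition L_north ::
  "real \<Rightarrow> (nat \<Rightarrow> real \<times> real) \<Rightarrow> nat \<Rightarrow> int \<Rightarrow> complex" where
  "L_north d t l m =
     (if m = 0 then of_real (snd (t l))
      else exp (of_real (\<bar>alpha d m\<bar> * snd (t l))) * exp (\<i> * of_real (alpha d m * fst (t l))))"

definition R_north ::
  "real \<Rightarrow> (nat \<Rightarrow> real \<times> real) \<Rightarrow> int \<Rightarrow> nat \<Rightarrow> complex" where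
  "R_north d s m j =
     (if m = 0 then of_real (snd (s j))
      else exp (of_real (- \<bar>alpha d m\<bar> * snd (s j))) * exp (- \<i> * of_real (alpha d m * fst (s j))))"

definition D_south :: "real \<Rightarrow> real \<Rightarrow> real \<Rightarrow> int \<Rightarrow> int \<Rightarrow> complex" where
  "D_south d \<xi> \<eta> m m' =
     (if m \<noteq> m' then 0
      else if m = 0 then of_real (- 1 / (2 * d * \<eta>))
      else of_real (1 / (4 * pi * \<bar>of_int m\<bar>))
             * (exp (- 2 * Q d \<xi> \<eta> m) / (1 - exp (- Q d \<xi> \<eta> m))))"

definition D_north :: "real \<Rightarrow> real \<Rightarrow> real \<Rightarrow> int \<Rightarrow> int \<Rightarrow> complex" where
  "D_north d \<xi> \<eta> m m' = cnj (D_south d \<xi> \<eta> m m')"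

definition mat_vec :: "'k set \<Rightarrow> ('i \<Rightarrow> 'k \<Rightarrow> complex) \<Rightarrow> ('k \<Rightarrow> complex) \<Rightarrow> 'i \<Rightarrow> complex" where
  "mat_vec I A v i = (\<Sum>k\<in>I. A i k * v k)"

definition LDR_north ::
  "real \<Rightarrow> real \<Rightarrow> real \<Rightarrow> int \<Rightarrow> nat \<Rightarrow> (nat \<Rightarrow> real \<times> real) \<Rightarrow> (nat \<Rightarrow> real \<times> real) \<Rightarrow>
   (nat \<Rightarrow> real) \<Rightarrow> nat \<Rightarrow> complex" where
  "LDR_north d \<xi> \<eta> M NS s t q =
     mat_vec {-M..M} (L_north d t)
       (mat_vec {-M..M} (D_north d \<xi> \<eta>)
         (mat_vec {1..NS} (R_north d s) (\<lambda>j. of_real (q j))))"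

end

theory Submission
  imports Defs
begin

text \<open>
  Shifting the contour in \<open>2 K\<^sub>0(\<beta> r) = \<integral> exp (- \<beta> r cosh t) dt\<close> by the angle of the vector
  \<open>(y, x)\<close> of length \<open>r\<close> and substituting \<open>k = \<beta> sinh t\<close> exhibits \<open>2 K\<^sub>0(\<beta> r)\<close> as the Fourier
  transform of \<open>exp (- \<chi> y) / \<chi>\<close> with \<open>\<chi> = \<surd>(k\<^sup>2 + \<beta>\<^sup>2)\<close>. Poisson summation turns each row of image
  sources into a Fourier series, and the sum over the rows \<open>n \<ge> 2\<close> is then geometric, which gives the
  factor \<open>exp (- 2 Q) / (1 - exp (- Q))\<close>. As \<open>\<beta>\<close> tends to 0 the modes \<open>m \<noteq> 0\<close> converge dominatedly,
  while the mode \<open>m = 0\<close> diverges like \<open>1/\<beta>\<^sup>2\<close>; expanding it to second order, neutrality and the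
  difference of two targets leave only \<open>- y y' / (2 d \<eta>)\<close>. Since \<open>y - y' \<le> \<eta>\<close> in the unit cell, the modes
  decay like \<open>exp (- 2 \<pi> \<eta> \<bar>m\<bar> / d)\<close>, and \<open>M\<close> is chosen to make the tail \<open>O(\<epsilon>)\<close>.
\<close>

section \<open>Integrability and summability of two-sided exponentials\<close>

lemma integrable_exp_minus_abs:
  fixes c :: real
  assumes "c > 0"
  shows "integrable lborel (\<lambda>x. exp (- c * \<bar>x\<bar>))"
proof -
  have "set_integrable lebesgue {0..} (\<lambda>x. exp (- c * x))"
    by (rule nonnegative_absolutely_integrable_1)
      (use integrable_on_exp_minus_to_infinity[OF assms] in auto)
  then have "set_integrable lborel {0..} (\<lambda>x. exp (- c * x))"
    unfolding set_integrable_def by (subst (asm) integrable_completion) auto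
  then have pos: "integrable lborel (\<lambda>x. indicator {0..} x *\<^sub>R exp (- c * x))"
    by (simp add: set_integrable_def)
  have neg: "integrable lborel (\<lambda>x. indicator {0..} (0 + (-1) * x) *\<^sub>R exp (- c * (0 + (-1) * x)))"
    by (rule lborel_integrable_real_affine[OF pos]) simp
  show ?thesis
    by (rule Bochner_Integration.integrable_bound[OF Bochner_Integration.integrable_add[OF pos neg]])
       (auto simp: indicator_def abs_if)
qed

lemma summable_on_exp_minus_abs_int:
  fixes c :: real
  assumes "c > 0"
  shows "(\<lambda>m::int. exp (- c * \<bar>of_int m\<bar>)) summable_on UNIV"
proof -
  have *: "(\<lambda>n::nat. exp (- c * real n)) summable_on UNIV"
    by (rule norm_summable_imp_summable_on)
       (use assms summable_geometric[of "exp (- c)"] in \<open>simp add: mult.commute flip: exp_of_nat_mult\<close>)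
  have "(\<lambda>m::int. exp (- c * \<bar>of_int m\<bar>)) summable_on (range int)"
    by (subst summable_on_reindex) (use * in \<open>auto simp: o_def\<close>)
  moreover have "(\<lambda>m::int. exp (- c * \<bar>of_int m\<bar>)) summable_on (range (\<lambda>n. - int n))"
    by (subst summable_on_reindex) (use * in \<open>auto simp: o_def inj_on_def\<close>)
  ultimately have "(\<lambda>m::int. exp (- c * \<bar>of_int m\<bar>)) summable_on (range int \<union> range (\<lambda>n. - int n))"
    by (rule summable_on_union)
  moreover have "range int \<union> range (\<lambda>n. - int n) = UNIV"
    by (auto simp: image_iff) (metis int_cases2)
  ultimately show ?thesis by simp
qed

section \<open>Poisson summation\<close>

lemma measurable_cis_linear [measurable]: "(\<lambda>x::real. cis (c * x)) \<in> borel_measurable borel"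
  by (intro borel_measurable_continuous_onI continuous_intros)

lemma round_eq_iff: "round x = j \<longleftrightarrow> of_int j - 1/2 \<le> x \<and> x < of_int j + (1/2 :: real)"
  by (auto simp: round_def floor_eq_iff)

lemma integral_cis_unit_interval:
  "(LINT x:{a..<a+1}|lborel. cis (- 2 * pi * of_int m * x)) = (if m = 0 then 1 else 0)"
proof -
  \<comment> \<open>The level sets of \<open>round\<close> are half-open intervals, while the
    fundamental theorem of calculus is applied on closed ones; the two differ by a null set.\<close>
  have "(LINT x:{a..<a+1}|lborel. cis (- 2 * pi * of_int m * x))
      = (LINT x:{a..a+1}|lborel. cis (- 2 * pi * of_int m * x))"
    unfolding set_lebesgue_integral_def
  proof (rule integral_cong_AE)
    show "AE x in lborel. indicator {a..<a+1} x *\<^sub>R cis (- 2 * pi * of_int m * x)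
        = indicator {a..a+1} x *\<^sub>R cis (- 2 * pi * of_int m * x)"
      using AE_lborel_singleton[of "a + 1"] by eventually_elim (auto simp: indicator_def)
  qed measurable
  also have "\<dots> = (if m = 0 then 1 else 0)"
  proof (cases "m = 0")
    case True
    then show ?thesis by (simp add: set_lebesgue_integral_def)
  next
    case False
    define F where "F = (\<lambda>x. cis (- 2 * pi * of_int m * x) * (\<i> / of_real (2 * pi * of_int m)))"
    have "(LINT x:{a..a+1}|lborel. cis (- 2 * pi * of_int m * x)) = F (a + 1) - F a"
      unfolding set_lebesgue_integral_def
    proof (rule integral_FTC_atLeastAtMost)
      show "(F has_vector_derivative cis (- 2 * pi * of_int m * x)) (at x within {a..a+1})" for x
        unfolding F_def cis_conv_exp using False
        by (auto intro!: derivative_eq_intros has_vector_derivative_real_field simp: field_simps)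
    qed (auto intro!: continuous_intros)
    moreover have "cis (- 2 * pi * of_int m * (a + 1)) = cis (- 2 * pi * of_int m * a)"
    proof -
      have "cis (- 2 * pi * of_int m * (a + 1)) = cis (- 2 * pi * of_int m * a) * cis (2 * pi * of_int (-m))"
        by (simp add: cis_mult algebra_simps)
      also have "cis (2 * pi * of_int (-m)) = 1"
        by (intro cis_multiple_2pi) auto
      finally show ?thesis by simp
    qed
    ultimately show ?thesis using False by (simp add: F_def)
  qed
  finally show ?thesis .
qed

text \<open>Each level set of \<open>round\<close> is a unit interval, a full period of every
  nonconstant character, so only the constant character sees the step function.\<close>

lemma integral_step_function:
  fixes b :: "int \<Rightarrow> complex"
  assumes int: "integrable lborel (\<lambda>x::real. b (round x))"
    and b: "b summable_on UNIV"
  shows "(LINT x|lborel. b (round x) * cis (- 2 * pi * of_int m * x)) = (if m = 0 then infsum b UNIV else 0)"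
proof -
  \<comment> \<open>\<open>int_decode\<close> enumerates the cells by natural numbers, as countable
    additivity of the integral requires; absolute convergence makes the order of enumeration
    harmless.\<close>
  define A where "A = (\<lambda>i::nat. {x::real. round x = int_decode i})"
  have A: "A i = {of_int (int_decode i) - 1/2 ..< of_int (int_decode i) - 1/2 + 1}" for i
    unfolding A_def round_eq_iff by auto
  have U: "(\<Union>i. A i) = UNIV"
    by (auto simp: A_def) (metis int_encode_inverse)
  let ?g = "\<lambda>x::real. b (round x) * cis (- 2 * pi * of_int m * x)"
  have int': "integrable lborel ?g"
    by (rule Bochner_Integration.integrable_bound[OF int])
       (use borel_measurable_integrable[OF int] measurable_cis_linear[of "- 2 * pi * of_int m"]
        in \<open>auto simp: norm_mult intro!: borel_measurable_times\<close>)
  have "(LINT x|lborel. ?g x) = (LINT x:(\<Union>i. A i)|lborel. ?g x)"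
    unfolding U by (simp add: set_lebesgue_integral_def)
  also have "\<dots> = (\<Sum>i. (LINT x:(A i)|lborel. ?g x))"
  proof (rule lebesgue_integral_countable_add)
    show "A i \<in> sets lborel" for i by (simp add: A)
    show "A i \<inter> A j = {}" if "i \<noteq> j" for i j
      using that inj_int_decode[of UNIV] by (auto simp: A_def dest: injD)
    show "set_integrable lborel (\<Union>i. A i) ?g"
      unfolding U using int' by (simp add: set_integrable_def)
  qed
  also have "\<dots> = (\<Sum>i. b (int_decode i) * (if m = 0 then 1 else 0))"
  proof (rule suminf_cong)
    fix i
    have "(LINT x:(A i)|lborel. ?g x) = (LINT x:(A i)|lborel. b (int_decode i) * cis (- 2 * pi * of_int m * x))"
    proof (rule set_lebesgue_integral_cong)
      show "A i \<in> sets lborel" by (simp add: A)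
    qed (simp add: A_def)
    also have "\<dots> = b (int_decode i) * (LINT x:(A i)|lborel. cis (- 2 * pi * of_int m * x))"
      by (rule set_integral_mult_right)
    finally show "(LINT x:(A i)|lborel. ?g x) = b (int_decode i) * (if m = 0 then 1 else 0)"
      unfolding A integral_cis_unit_interval .
  qed
  also have "\<dots> = (if m = 0 then infsum b UNIV else 0)"
  proof -
    have "((\<lambda>i. b (int_decode i)) has_sum infsum b UNIV) UNIV"
      by (subst has_sum_reindex_bij_betw[OF bij_int_decode]) (use b in simp)
    then have "(\<Sum>i. b (int_decode i)) = infsum b UNIV"
      by (metis has_sum_imp_sums sums_unique)
    then show ?thesis by simp
  qed
  finally show ?thesis .
qed

text \<open>The chord has length \<open>2 * \<bar>sin (pi * u)\<bar>\<close>, and sine is bounded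
  below linearly up to pi/2. The constant is not optimal; any positive one would control the Fejer
  kernel near the integers.\<close>

lemma abs_le_norm_one_minus_cis:
  assumes "\<bar>u\<bar> \<le> 1/2"
  shows "\<bar>u\<bar> \<le> norm (1 - cis (2 * pi * u))"
proof -
  have *: "u \<le> 2 * sin (pi * u)" if u: "0 < u" "u \<le> 1/2" for u
  proof -
    \<comment> \<open>At the half angle, y is at most pi/4, so cosine is at least 1/sqrt 2 on
      [0, y]. The mean value theorem gives sin y \<ge> y / sqrt 2, and doubling the angle gives sin
      (2 y) \<ge> y.\<close>
    define y where "y = pi * u / 2"
    have y: "0 < y" "y \<le> pi / 4"
      using u by (auto simp: y_def field_simps)
    have cy: "cos z \<ge> 1 / sqrt 2" if "0 \<le> z" "z \<le> y" for z
    proof -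
      have "1 / sqrt 2 = cos (pi/4)"
        using real_div_sqrt[of 2] by (simp add: cos_45 divide_simps)
      also have "\<dots> \<le> cos z"
        using that y by (intro cos_monotone_0_pi_le) auto
      finally show ?thesis .
    qed
    have "\<exists>z>0. z < y \<and> sin y - sin 0 = (y - 0) * cos z"
      by (rule MVT2) (use y in \<open>auto intro!: derivative_eq_intros\<close>)
    then obtain z where z: "0 < z" "z < y" "sin y = y * cos z" by auto
    have "y * (1 / sqrt 2) \<le> sin y"
      unfolding z(3) using y z cy[of z] by (intro mult_left_mono) auto
    then have "y * (1 / sqrt 2) * (1 / sqrt 2) \<le> sin y * cos y"
      using y cy[of y] by (intro mult_mono) (auto intro!: sin_ge_zero)
    then have "y \<le> sin (2 * y)"
      by (simp add: sin_double)
    then have "pi * u \<le> 2 * sin (pi * u)"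
      by (simp add: y_def)
    moreover have "u \<le> pi * u" using u pi_gt3 by simp
    ultimately show ?thesis by linarith
  qed
  have n: "norm (1 - cis (2 * pi * u)) = 2 * \<bar>sin (pi * u)\<bar>"
  proof -
    have "(norm (1 - cis (2 * pi * u)))\<^sup>2 = (1 - cos (2 * (pi * u)))\<^sup>2 + (sin (2 * (pi * u)))\<^sup>2"
      by (simp add: cmod_power2 mult.assoc)
    also have "\<dots> = (2 * (sin (pi * u))\<^sup>2)\<^sup>2 + (2 * sin (pi * u) * cos (pi * u))\<^sup>2"
      by (simp only: cos_double_sin sin_double) simp
    also have "\<dots> = 4 * (sin (pi * u))\<^sup>2 * ((sin (pi * u))\<^sup>2 + (cos (pi * u))\<^sup>2)"
      by (simp only: power2_eq_square) algebra
    also have "\<dots> = (2 * \<bar>sin (pi * u)\<bar>)\<^sup>2"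
      by (simp add: power_mult_distrib)
    finally show ?thesis
      by (rule power2_eq_imp_eq) auto
  qed
  consider "u = 0" | "u > 0" | "u < 0" by linarith
  then show ?thesis
  proof cases
    case 2
    then show ?thesis using *[of u] assms n by auto
  next
    case 3
    then show ?thesis using *[of "-u"] assms n by auto
  qed (use n in auto)
qed

text \<open>Rows of the double sum are finite partial sums of \<open>a\<close>. With nonnegative
  terms each row is at most the full sum, and all but boundedly many rows contain a given finite
  set, so the row average squeezes the sum from both sides.\<close>

lemma has_sum_of_double_cesaro:
  fixes a :: "int \<Rightarrow> real"
  assumes nonneg: "\<And>m. a m \<ge> 0"
    and lim: "(\<lambda>N. (\<Sum>p<N. \<Sum>q<N. a (int p - int q)) / real N) \<longlonglongrightarrow> s"
  shows "(a has_sum s) UNIV"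
proof -
  have finite_le: "sum a F \<le> s" if F: "finite F" for F
  proof -
    obtain M :: nat where M: "F \<subseteq> {- int M..int M}"
    proof -
      obtain k where "\<And>x. x \<in> F \<Longrightarrow> \<bar>x\<bar> \<le> k"
        using bdd_above_finite[of "abs ` F"] F by (auto simp: bdd_above_def)
      then show ?thesis by (intro that[of "nat k"]) (force simp: abs_le_iff)
    qed
    \<comment> \<open>For M \<le> p < N - M the differences p - q with q < N cover all of [-M, M],
      hence F. At least N - 2 M rows are therefore no smaller than \<open>sum a F\<close>.\<close>
    have bound: "(real N - 2 * real M) / real N * sum a F \<le> (\<Sum>p<N. \<Sum>q<N. a (int p - int q)) / real N"
      if N: "N > 2 * M" for N
    proof -
      have "sum a F \<le> (\<Sum>q<N. a (int p - int q))" if p: "p \<in> {M..<N-M}" for p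
      proof -
        have "sum a F \<le> sum a ((\<lambda>q. int p - int q) ` {..<N})"
        proof (rule sum_mono2)
          show "F \<subseteq> (\<lambda>q. int p - int q) ` {..<N}"
          proof
            fix x assume "x \<in> F"
            then have "- int M \<le> x" "x \<le> int M" using M by auto
            then have "x = int p - int (nat (int p - x))" "nat (int p - x) < N"
              using p by auto
            then show "x \<in> (\<lambda>q. int p - int q) ` {..<N}" by blast
          qed
        qed (use nonneg in auto)
        also have "\<dots> = (\<Sum>q<N. a (int p - int q))"
          by (subst sum.reindex) (auto simp: inj_on_def)
        finally show ?thesis .
      qed
      then have "(\<Sum>p\<in>{M..<N-M}. sum a F) \<le> (\<Sum>p\<in>{M..<N-M}. \<Sum>q<N. a (int p - int q))"
        by (rule sum_mono)
      also have "\<dots> \<le> (\<Sum>p<N. \<Sum>q<N. a (int p - int q))"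
        by (rule sum_mono2) (auto intro!: sum_nonneg nonneg)
      finally have "(real N - 2 * real M) * sum a F \<le> (\<Sum>p<N. \<Sum>q<N. a (int p - int q))"
        using N by (simp add: of_nat_diff)
      then show ?thesis
        using N by (simp add: divide_right_mono)
    qed
    have "(\<lambda>N. (real N - 2 * real M) / real N * sum a F) \<longlonglongrightarrow> 1 * sum a F"
      by (intro tendsto_intros) real_asymp
    then have "1 * sum a F \<le> s"
      by (rule LIMSEQ_le[OF _ lim]) (intro exI[of _ "Suc (2 * M)"] allI impI bound, simp)
    then show ?thesis by simp
  qed
  have summable: "a summable_on UNIV"
    by (rule nonneg_bdd_above_summable_on) (auto intro!: bdd_aboveI2[of _ _ s] nonneg finite_le)
  have "infsum a UNIV \<le> s"
    by (rule infsum_le_finite_sums[OF summable finite_le])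
  moreover have "s \<le> infsum a UNIV"
  proof (rule LIMSEQ_le_const2[OF lim], intro exI[of _ 1] allI impI)
    fix N :: nat assume N: "1 \<le> N"
    have "(\<Sum>q<N. a (int p - int q)) \<le> infsum a UNIV" for p
    proof -
      have "(\<Sum>q<N. a (int p - int q)) = sum a ((\<lambda>q. int p - int q) ` {..<N})"
        by (subst sum.reindex) (auto simp: inj_on_def)
      also have "\<dots> \<le> infsum a UNIV"
        by (rule finite_sum_le_infsum[OF summable]) (auto intro: nonneg)
      finally show ?thesis .
    qed
    then have "(\<Sum>p<N. \<Sum>q<N. a (int p - int q)) \<le> (\<Sum>p<N. infsum a UNIV)"
      by (rule sum_mono)
    then show "(\<Sum>p<N. \<Sum>q<N. a (int p - int q)) / real N \<le> infsum a UNIV"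
      using N by (simp add: divide_le_eq mult.commute)
  qed
  ultimately have "infsum a UNIV = s" by simp
  then show ?thesis using summable by (simp add: has_sum_iff)
qed

text \<open>The Fejer kernel as a double sum of characters, so that integrating against it produces
  the averages of \<open>has_sum_of_double_cesaro\<close> directly.\<close>

definition fejer :: "nat \<Rightarrow> real \<Rightarrow> complex" where
  "fejer N x = (\<Sum>p<N. \<Sum>q<N. cis (- 2 * pi * of_int (int p - int q) * x)) / of_nat N"

text \<open>The double sum factors into a geometric sum times its conjugate.\<close>

lemma norm_fejer: "norm (fejer N x) = (norm (\<Sum>p<N. cis (- 2 * pi * x) ^ p))\<^sup>2 / N"
proof -
  define w where "w = cis (- 2 * pi * x)"
  have "cis (- 2 * pi * of_int (int p - int q) * x) = w ^ p * cnj (w ^ q)" for p q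
    unfolding w_def Complex.DeMoivre cis_cnj cis_mult
    by (simp add: algebra_simps)
  then have "fejer N x = (\<Sum>p<N. w ^ p) * cnj (\<Sum>p<N. w ^ p) / of_nat N"
    by (simp add: fejer_def sum_product)
  then show ?thesis
    by (simp only: norm_divide norm_mult complex_mod_cnj norm_of_nat power2_eq_square w_def)
qed

lemma norm_one_minus_cis_geometric_sum_le:
  "norm (1 - cis t) * norm (\<Sum>p<N. cis t ^ p) \<le> 2"
proof -
  have "norm (1 - cis t) * norm (\<Sum>p<N. cis t ^ p) = norm (1 - cis t ^ N)"
    by (simp add: one_diff_power_eq norm_mult)
  also have "\<dots> \<le> 2"
    by (rule order_trans[OF norm_triangle_ineq4]) (simp add: norm_power)
  finally show ?thesis .
qed

lemma abs_round_le_norm_one_minus_cis: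
  "\<bar>x - of_int (round x)\<bar> \<le> norm (1 - cis (- 2 * pi * x))"
proof -
  have "\<bar>of_int (round x) - x\<bar> \<le> norm (1 - cis (2 * pi * (of_int (round x) - x)))"
    by (rule abs_le_norm_one_minus_cis) (rule of_int_round_abs_le)
  also have "cis (2 * pi * (of_int (round x) - x)) = cis (2 * pi * of_int (round x)) * cis (- 2 * pi * x)"
    by (simp add: cis_mult algebra_simps)
  also have "cis (2 * pi * of_int (round x)) = 1"
    by (rule cis_multiple_2pi) auto
  finally show ?thesis by (simp add: abs_minus_commute)
qed

text \<open>Of the two equal factors in \<open>norm_fejer\<close>, one is bounded by 2 over the
  distance to the nearest integer and the other by N, which cancels the denominator. This bound
  uniform in N supplies the dominating function in the Poisson formula.\<close>

lemma abs_round_mult_norm_fejer_le: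
  "\<bar>x - of_int (round x)\<bar> * norm (fejer N x) \<le> 2"
proof (cases "N = 0")
  case False
  define s where "s = norm (\<Sum>p<N. cis (- 2 * pi * x) ^ p)"
  have "s \<le> (\<Sum>p<N. norm (cis (- 2 * pi * x) ^ p))"
    unfolding s_def by (rule norm_sum)
  then have sN: "s / N \<le> 1" using False by (simp add: norm_power)
  have "\<bar>x - of_int (round x)\<bar> * s \<le> norm (1 - cis (- 2 * pi * x)) * s"
    by (intro mult_right_mono abs_round_le_norm_one_minus_cis) (simp add: s_def)
  also have "\<dots> \<le> 2"
    unfolding s_def by (rule norm_one_minus_cis_geometric_sum_le)
  finally have "\<bar>x - of_int (round x)\<bar> * s * (s / N) \<le> 2 * 1"
    using sN by (intro mult_mono) (auto simp: s_def)
  then show ?thesis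
    by (simp add: norm_fejer s_def power2_eq_square mult_ac)
qed (simp add: fejer_def)

text \<open>Away from the integers both geometric factors stay bounded, so the denominator N
  wins.\<close>

lemma fejer_tendsto_0:
  assumes "x \<noteq> of_int (round x)"
  shows "(\<lambda>N. fejer N x) \<longlonglongrightarrow> 0"
proof (rule Lim_null_comparison)
  define u where "u = norm (1 - cis (- 2 * pi * x))"
  have u: "u > 0"
    unfolding u_def using assms by (intro less_le_trans[OF _ abs_round_le_norm_one_minus_cis]) simp
  have "norm (fejer N x) \<le> (2 / u)\<^sup>2 / real N" for N
  proof -
    have "norm (\<Sum>p<N. cis (- 2 * pi * x) ^ p) \<le> 2 / u"
      using norm_one_minus_cis_geometric_sum_le[of "- 2 * pi * x" N] u
      by (simp add: u_def field_simps)
    then show ?thesis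
      unfolding norm_fejer by (intro divide_right_mono power_mono) auto
  qed
  then show "\<forall>\<^sub>F N in sequentially. norm (fejer N x) \<le> (2 / u)\<^sup>2 / real N"
    by (intro always_eventually allI)
  show "(\<lambda>N. (2 / u)\<^sup>2 / real N) \<longlonglongrightarrow> 0"
    by (rule lim_const_over_n)
qed

lemma measurable_fejer [measurable]: "fejer N \<in> borel_measurable borel"
  unfolding fejer_def divide_inverse
  by (intro borel_measurable_continuous_onI continuous_intros)

text \<open>The step function \<open>h \<circ> round\<close> has the Fourier coefficients of a point mass of size \<open>\<Sum>j. h j\<close>,
  and \<open>h - h \<circ> round\<close> is small enough near the integers to make its integral against the Fejer
  kernel vanish in the limit. Nonnegativity of \<open>a\<close> upgrades Cesaro summability to summability.\<close>

lemma poisson_summation_nonneg: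
  fixes h h' :: "real \<Rightarrow> complex" and a :: "int \<Rightarrow> real"
  assumes c: "c > 0"
    and deriv: "\<And>x. (h has_vector_derivative h' x) (at x)"
    and bound: "\<And>x. norm (h x) \<le> B * exp (- c * \<bar>x\<bar>)"
    and bound': "\<And>x. norm (h' x) \<le> B * exp (- c * \<bar>x\<bar>)"
    and a: "\<And>m. (LINT x|lborel. h x * cis (- 2 * pi * of_int m * x)) = of_real (a m)"
    and nonneg: "\<And>m. a m \<ge> 0"
  shows "((\<lambda>m. complex_of_real (a m)) has_sum (\<Sum>\<^sub>\<infinity>j. h (of_int j))) UNIV"
proof -
  define S where "S = (\<Sum>\<^sub>\<infinity>j. h (of_int j))"
  define \<delta> where "\<delta> = (\<lambda>x. h x - h (of_int (round x)))"
  have B: "B \<ge> 0" using order_trans[OF norm_ge_zero bound[of 0]] by simp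
  have h_meas [measurable]: "h \<in> borel_measurable borel"
    by (intro borel_measurable_continuous_onI continuous_at_imp_continuous_on)
       (auto intro: has_vector_derivative_continuous deriv)
  have \<delta>_meas [measurable]: "\<delta> \<in> borel_measurable borel"
    unfolding \<delta>_def round_def by measurable
  \<comment> \<open>The mean value inequality on the segment from \<open>round x\<close> to x.
    Points of that segment are within 1/2 of x, which costs the factor \<open>exp (c / 2)\<close> in
    the decay.\<close>
  have \<delta>_bound: "norm (\<delta> x) \<le> B * exp (c / 2) * exp (- c * \<bar>x\<bar>) * \<bar>x - of_int (round x)\<bar>" for x
  proof -
    define y where "y = real_of_int (round x)"
    have "norm (h x - h y) \<le> B * exp (c / 2) * exp (- c * \<bar>x\<bar>) * norm (x - y)"
    proof (rule differentiable_bound[where S = "closed_segment y x" and f' = "\<lambda>z t. t *\<^sub>R h' z"])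
      fix z assume "z \<in> closed_segment y x"
      then show "(h has_derivative (\<lambda>t. t *\<^sub>R h' z)) (at z within closed_segment y x)"
        using deriv[of z] by (simp add: has_vector_derivative_def has_derivative_at_withinI)
      have "\<bar>z - x\<bar> \<le> \<bar>y - x\<bar>"
        using \<open>z \<in> _\<close> by (auto simp: closed_segment_eq_real_ivl split: if_splits)
      also have "\<dots> \<le> 1/2"
        using of_int_round_abs_le[of x] by (simp add: y_def)
      finally have "\<bar>x\<bar> \<le> \<bar>z\<bar> + 1/2" by linarith
      then have "c * \<bar>x\<bar> \<le> c * (\<bar>z\<bar> + 1/2)"
        using c by (intro mult_left_mono) auto
      then have "exp (- c * \<bar>z\<bar>) \<le> exp (c / 2) * exp (- c * \<bar>x\<bar>)"
        by (simp add: exp_add[symmetric] algebra_simps)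
      then have "norm (h' z) \<le> B * exp (c / 2) * exp (- c * \<bar>x\<bar>)"
        unfolding mult.assoc by (intro order_trans[OF bound'[of z]] mult_left_mono B)
      then show "onorm (\<lambda>t. t *\<^sub>R h' z) \<le> B * exp (c / 2) * exp (- c * \<bar>x\<bar>)"
        by (intro onorm_le) (simp, subst mult.commute, rule mult_left_mono, auto)
    qed auto
    then show ?thesis by (simp add: \<delta>_def y_def)
  qed
  have int_exp: "integrable lborel (\<lambda>x. K * exp (- c * \<bar>x\<bar>))" for K
    by (intro integrable_mult_right integrable_exp_minus_abs c)
  have int_h: "integrable lborel h"
    by (rule Bochner_Integration.integrable_bound[OF int_exp[of B]]) (use bound B in auto)
  have int_\<delta>: "integrable lborel \<delta>"
  proof (rule Bochner_Integration.integrable_bound[OF int_exp[of "B * exp (c / 2)"]])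
    have "norm (\<delta> x) \<le> B * exp (c / 2) * exp (- c * \<bar>x\<bar>) * 1" for x
      using of_int_round_abs_le[of x] B
      by (intro order_trans[OF \<delta>_bound] mult_left_mono) (auto simp: abs_minus_commute)
    then show "AE x in lborel. norm (\<delta> x) \<le> norm (B * exp (c / 2) * exp (- c * \<bar>x\<bar>))"
      using B by (intro AE_I2) simp
  qed simp
  have int_step: "integrable lborel (\<lambda>x::real. h (of_int (round x)))"
    using Bochner_Integration.integrable_diff[OF int_h int_\<delta>] by (simp add: \<delta>_def)
  have summable_h: "(\<lambda>j. h (of_int j)) summable_on UNIV"
  proof (rule Infinite_Sum.abs_summable_summable, rule Infinite_Sum.abs_summable_on_comparison_test')
    show "(\<lambda>j::int. B * exp (- c * \<bar>of_int j\<bar>)) summable_on UNIV"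
      by (intro summable_on_cmult_right summable_on_exp_minus_abs_int c)
  qed (rule bound)
  have int_cis: "integrable lborel (\<lambda>x. f x * cis (b * x))" if "integrable lborel f" for f :: "real \<Rightarrow> complex" and b
    by (rule Bochner_Integration.integrable_bound[OF that])
       (use borel_measurable_integrable[OF that] in \<open>auto simp: norm_mult intro!: borel_measurable_times\<close>)
  have coeff: "(LINT x|lborel. \<delta> x * cis (- 2 * pi * of_int m * x)) = of_real (a m) - (if m = 0 then S else 0)" for m
    unfolding \<delta>_def left_diff_distrib S_def
    by (subst Bochner_Integration.integral_diff[OF int_cis[OF int_h] int_cis[OF int_step]])
       (simp only: a integral_step_function[OF int_step summable_h])
  \<comment> \<open>The linear vanishing of \<open>\<delta>\<close> at the integers compensates the
    growth of the Fejer kernel there, leaving an integrable exponential as the majorant.\<close>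
  have "(\<lambda>N. LINT x|lborel. \<delta> x * fejer N x) \<longlonglongrightarrow> (LINT x::real|lborel. 0)"
  proof (rule integral_dominated_convergence[where w = "\<lambda>x. 2 * B * exp (c / 2) * exp (- c * \<bar>x\<bar>)"])
    show "(\<lambda>x. \<delta> x * fejer N x) \<in> borel_measurable lborel" for N
      by simp
    show "AE x in lborel. (\<lambda>N. \<delta> x * fejer N x) \<longlonglongrightarrow> 0"
    proof (rule AE_I2)
      fix x show "(\<lambda>N. \<delta> x * fejer N x) \<longlonglongrightarrow> 0"
      proof (cases "x = of_int (round x)")
        case True
        then show ?thesis by (simp add: \<delta>_def)
      next
        case False
        then show ?thesis by (intro tendsto_mult_right_zero fejer_tendsto_0)
      qed
    qed
    show "AE x in lborel. norm (\<delta> x * fejer N x) \<le> 2 * B * exp (c / 2) * exp (- c * \<bar>x\<bar>)" for N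
    proof (rule AE_I2)
      fix x
      have "norm (\<delta> x * fejer N x) \<le> B * exp (c / 2) * exp (- c * \<bar>x\<bar>) * \<bar>x - of_int (round x)\<bar> * norm (fejer N x)"
        unfolding norm_mult by (intro mult_right_mono \<delta>_bound) auto
      also have "\<dots> \<le> B * exp (c / 2) * exp (- c * \<bar>x\<bar>) * 2"
        unfolding mult.assoc[of "B * exp (c / 2) * exp (- c * \<bar>x\<bar>)"]
        using B by (intro mult_left_mono abs_round_mult_norm_fejer_le) auto
      finally show "norm (\<delta> x * fejer N x) \<le> 2 * B * exp (c / 2) * exp (- c * \<bar>x\<bar>)"
        by (simp add: mult_ac)
    qed
    show "integrable lborel (\<lambda>x. 2 * B * exp (c / 2) * exp (- c * \<bar>x\<bar>))"
      by (rule int_exp)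
  qed simp
  \<comment> \<open>The N diagonal terms p = q each contribute S, which after division by N leaves a
    single S. For N = 0 everything is 0, since division by 0 gives 0.\<close>
  moreover have "(LINT x|lborel. \<delta> x * fejer N x)
      = of_real ((\<Sum>p<N. \<Sum>q<N. a (int p - int q)) / real N) - (if N = 0 then 0 else S)" for N
  proof -
    have "(LINT x|lborel. \<delta> x * fejer N x)
        = (LINT x|lborel. (\<Sum>p<N. \<Sum>q<N. \<delta> x * cis (- 2 * pi * of_int (int p - int q) * x))) / of_nat N"
      by (simp add: fejer_def sum_distrib_left)
    also have "\<dots> = (\<Sum>p<N. \<Sum>q<N. of_real (a (int p - int q)) - (if int p - int q = 0 then S else 0)) / of_nat N"
      by (simp only: Bochner_Integration.integral_sum Bochner_Integration.integrable_sum int_cis[OF int_\<delta>] coeff)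
    also have "\<dots> = of_real ((\<Sum>p<N. \<Sum>q<N. a (int p - int q)) / real N) - (if N = 0 then 0 else S)"
      by (simp add: sum_subtractf diff_divide_distrib sum.delta')
    finally show ?thesis .
  qed
  ultimately have "(\<lambda>N. of_real ((\<Sum>p<N. \<Sum>q<N. a (int p - int q)) / real N) - (if N = 0 then 0 else S)) \<longlonglongrightarrow> 0"
    by simp
  then have "(\<lambda>N. of_real ((\<Sum>p<N. \<Sum>q<N. a (int p - int q)) / real N) - S) \<longlonglongrightarrow> 0"
  proof (rule Lim_transform_eventually)
    show "\<forall>\<^sub>F N in sequentially. of_real ((\<Sum>p<N. \<Sum>q<N. a (int p - int q)) / real N) - (if N = 0 then 0 else S)
        = of_real ((\<Sum>p<N. \<Sum>q<N. a (int p - int q)) / real N) - S"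
      using eventually_gt_at_top[of 0] by eventually_elim simp
  qed
  then have lim: "(\<lambda>N. complex_of_real ((\<Sum>p<N. \<Sum>q<N. a (int p - int q)) / real N)) \<longlonglongrightarrow> S"
    by (simp add: LIM_zero_iff)
  \<comment> \<open>S is a limit of real averages; its reality allows passing to the real-valued
    Cesaro lemma.\<close>
  have "S \<in> \<real>"
    by (rule closed_sequentially[OF closed_complex_Reals _ lim]) auto
  then have S: "S = of_real (Re S)" by (simp add: complex_is_Real_iff complex_eq_iff)
  have "(a has_sum Re S) UNIV"
    using tendsto_Re[OF lim] by (intro has_sum_of_double_cesaro nonneg) simp
  then show ?thesis
    unfolding S_def[symmetric] by (subst S) (simp only: has_sum_of_real_iff)
qed

section \<open>The modified Bessel function of order zero\<close>

lemma cosh_ge_abs: "cosh (t::real) \<ge> \<bar>t\<bar>"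
proof -
  have *: "cosh u \<ge> u" if "u \<ge> 0" for u :: real
  proof -
    have "exp u \<ge> 1 + u + u\<^sup>2 / 2"
      using exp_lower_Taylor_quadratic[OF that] by simp
    moreover have "u\<^sup>2 \<ge> 2 * u - 1"
      using zero_le_power2[of "u - 1"] by (simp add: power2_eq_square algebra_simps)
    ultimately have "exp u + exp (-u) \<ge> 2 * u"
      using exp_gt_zero[of "-u"] by linarith
    then show ?thesis
      by (simp add: cosh_def)
  qed
  show ?thesis
    using *[of t] *[of "-t"] by (cases "t \<ge> 0") auto
qed

lemma cosh_complex_of_real: "cosh (complex_of_real t) = of_real (cosh t)"
  and sinh_complex_of_real: "sinh (complex_of_real t) = of_real (sinh t)"
  by (simp_all add: cosh_def sinh_def scaleR_conv_of_real flip: exp_of_real)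

lemma integrable_exp_minus_cosh:
  fixes z :: real
  assumes "z > 0"
  shows "integrable lborel (\<lambda>t. exp (- z * cosh t))"
proof (rule Bochner_Integration.integrable_bound[OF integrable_exp_minus_abs[OF assms]])
  show "(\<lambda>t::real. exp (- z * cosh t)) \<in> borel_measurable lborel"
    by (simp, intro borel_measurable_continuous_onI continuous_intros)
  have "z * \<bar>t\<bar> \<le> z * cosh t" for t
    using assms cosh_ge_abs[of t] by (intro mult_left_mono) auto
  then show "AE t in lborel. norm (exp (- z * cosh t)) \<le> norm (exp (- z * \<bar>t\<bar>))"
    by simp
qed

text \<open>The integrand is even and \<open>cosh (0 * t) = 1\<close>, so the half line in
  \<open>bessel_K\<close> carries half of the integral. The whole line is the form in which the
  contour can be shifted.\<close>

lemma integral_exp_minus_cosh_eq_bessel_K: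
  assumes "z > 0"
  shows "(LINT t|lborel. exp (- z * cosh t)) = 2 * bessel_K 0 z"
proof -
  let ?f = "\<lambda>t::real. exp (- z * cosh t)"
  have int: "set_integrable lborel A ?f" if "A \<in> sets lborel" for A
    using integrable_mult_indicator[OF that integrable_exp_minus_cosh[OF assms]]
    by (simp add: set_integrable_def)
  have "(LINT t|lborel. ?f t) = (LINT t:UNIV|lborel. ?f t)"
    by (simp add: set_lebesgue_integral_def)
  also have "\<dots> = (LINT t:{..<0} \<union> {0..}|lborel. ?f t)"
    by (rule arg_cong[where f = "\<lambda>A. set_lebesgue_integral lborel A ?f"]) auto
  also have "\<dots> = (LINT t:{..<0}|lborel. ?f t) + (LINT t:{0..}|lborel. ?f t)"
    by (rule set_integral_Un[OF _ int int]) auto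
  also have "(LINT t:{..<0}|lborel. ?f t) = (LINT t:{0<..}|lborel. ?f t)"
    unfolding set_lebesgue_integral_def
    by (subst lborel_integral_real_affine[where c = "-1" and t = 0])
       (auto simp: indicator_def intro!: Bochner_Integration.integral_cong)
  also have "\<dots> = (LINT t:{0..}|lborel. ?f t)"
    unfolding set_lebesgue_integral_def
  proof (rule integral_cong_AE)
    show "AE t in lborel. indicator {0<..} t *\<^sub>R ?f t = indicator {0..} t *\<^sub>R ?f t"
      using AE_lborel_singleton[of 0] by eventually_elim (auto simp: indicator_def)
  qed (use int[of "{0<..}"] int[of "{0..}"] in \<open>auto simp: set_integrable_def\<close>)
  finally show ?thesis by (simp add: bessel_K_def)
qed

lemma cosh_diff_i:
  "cosh (of_real t - \<i> * of_real \<theta>) = Complex (cosh t * cos \<theta>) (- sinh t * sin \<theta>)"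
proof -
  have "cosh (\<i> * complex_of_real \<theta>) = of_real (cos \<theta>)" "sinh (\<i> * complex_of_real \<theta>) = \<i> * of_real (sin \<theta>)"
    by (simp_all add: cosh_conv_cos sinh_conv_sin mult.assoc[symmetric] flip: cos_of_real sin_of_real)
  then show ?thesis
    by (simp add: cosh_diff complex_eq_iff cosh_complex_of_real sinh_complex_of_real)
qed

text \<open>The integral over \<open>[-T, T]\<close>, as a function of a complex shift of the variable, has a boundary
  term as its derivative, and that term vanishes as \<open>T\<close> grows.\<close>

lemma integral_exp_minus_cosh_shift:
  fixes z \<theta> :: real
  assumes z: "z > 0" and \<theta>: "\<bar>\<theta>\<bar> < pi / 2"
  shows "(LINT t|lborel. exp (- of_real z * cosh (of_real t - \<i> * of_real \<theta>)))
       = complex_of_real (LINT t|lborel. exp (- z * cosh t))"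
proof -
  define F where "F = (\<lambda>w::complex. exp (- of_real z * cosh w))"
  define F' where "F' = (\<lambda>w::complex. F w * (- of_real z * sinh w))"
  have F_deriv: "(F has_field_derivative F' w) (at w)" for w
    unfolding F_def F'_def by (auto intro!: derivative_eq_intros)
  have cont: "continuous_on A F" "continuous_on A F'" for A
    unfolding F_def F'_def by (intro continuous_intros)+
  have cos_pos: "cos \<phi> \<ge> cos \<theta>" if "\<bar>\<phi>\<bar> \<le> \<bar>\<theta>\<bar>" for \<phi>
  proof -
    have "cos \<bar>\<theta>\<bar> \<le> cos \<bar>\<phi>\<bar>" using that \<theta> pi_gt_zero by (intro cos_monotone_0_pi_le) linarith+
    then show ?thesis by simp
  qed
  have c: "cos \<theta> > 0" using \<theta> by (intro cos_gt_zero_pi) auto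
  \<comment> \<open>The real part of \<open>cosh (t - \<i> * \<phi>)\<close> is
    \<open>cosh t * cos \<phi>\<close>, and the cosine stays above \<open>cos \<theta> > 0\<close>
    throughout the strip, which gives one bound for all intermediate shifts.\<close>
  have norm_F: "norm (F (of_real t - \<i> * of_real \<phi>)) \<le> exp (- (z * cos \<theta>) * cosh t)"
    if "\<bar>\<phi>\<bar> \<le> \<bar>\<theta>\<bar>" for t \<phi>
    using z cos_pos[OF that] by (simp add: F_def cosh_diff_i mult.assoc mult_ac)
  define I where "I = (\<lambda>T w. integral (cbox (-T) T) (\<lambda>t. F (of_real t + w)))"
  have I_deriv: "(I T has_field_derivative (F (of_real T + w) - F (- of_real T + w))) (at w)" if "T \<ge> 0" for T w
  proof -
    have "(I T has_field_derivative integral (cbox (-T) T) (\<lambda>t. F' (of_real t + w))) (at w within UNIV)"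
      unfolding I_def
    proof (rule leibniz_rule_field_derivative)
      show "((\<lambda>w. F (of_real t + w)) has_field_derivative F' (of_real t + w)) (at w within UNIV)" for t w
        by (rule DERIV_chain'[OF _ F_deriv, where D = 1, simplified]) (auto intro!: derivative_eq_intros)
      show "(\<lambda>t. F (of_real t + w)) integrable_on cbox (-T) T" for w
        by (intro integrable_continuous continuous_on_compose2[OF cont(1)[of UNIV]] continuous_intros) auto
      show "continuous_on (UNIV \<times> cbox (-T) T) (\<lambda>(w, t). F' (of_real t + w))"
        unfolding split_def
        by (intro continuous_on_compose2[OF cont(2)[of UNIV]] continuous_intros) auto
    qed auto
    also have "integral (cbox (-T) T) (\<lambda>t. F' (of_real t + w)) = F (of_real T + w) - F (of_real (- T) + w)"
    proof (subst box_real, rule integral_unique, rule fundamental_theorem_of_calculus)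
      show "((\<lambda>t. F (of_real t + w)) has_vector_derivative F' (of_real t + w)) (at t within {-T..T})" for t
        by (rule has_vector_derivative_real_field, rule DERIV_chain'[OF _ F_deriv, where D = 1, simplified])
           (auto intro!: derivative_eq_intros)
    qed (use that in auto)
    finally show ?thesis by simp
  qed
  \<comment> \<open>Integrate the derivative of I along the vertical segment of length
    \<bar>\<theta>\<bar>; each of the two boundary terms is at most the bound in
    \<open>norm_F\<close>.\<close>
  have I_diff: "norm (I T (- \<i> * of_real \<theta>) - I T 0) \<le> 2 * exp (- (z * cos \<theta>) * cosh T) * \<bar>\<theta>\<bar>" if "T \<ge> 0" for T
  proof -
    have "norm (I T (- \<i> * of_real \<theta>) - I T 0) \<le> 2 * exp (- (z * cos \<theta>) * cosh T) * norm (- \<i> * of_real \<theta> - 0)"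
    proof (rule field_differentiable_bound[where S = "closed_segment 0 (- \<i> * of_real \<theta>)"])
      fix w assume "w \<in> closed_segment 0 (- \<i> * complex_of_real \<theta>)"
      then obtain u where u: "0 \<le> u" "u \<le> 1" "w = - \<i> * of_real (u * \<theta>)"
        by (auto simp: closed_segment_def scaleR_conv_of_real)
      have le: "\<bar>u * \<theta>\<bar> \<le> \<bar>\<theta>\<bar>" using u by (simp add: abs_mult mult_left_le_one_le)
      show "(I T has_field_derivative (F (of_real T + w) - F (- of_real T + w))) (at w within closed_segment 0 (- \<i> * of_real \<theta>))"
        by (rule has_field_derivative_at_within[OF I_deriv[OF that]])
      show "norm (F (of_real T + w) - F (- of_real T + w)) \<le> 2 * exp (- (z * cos \<theta>) * cosh T)"
        using norm_triangle_ineq4[of "F (of_real T + w)" "F (- of_real T + w)"]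
          norm_F[OF le, of T] norm_F[OF le, of "-T"] by (simp add: u(3))
    qed auto
    then show ?thesis by (simp add: norm_mult)
  qed
  have int: "integrable lborel (\<lambda>t. F (of_real t - \<i> * of_real \<phi>))" if "\<bar>\<phi>\<bar> \<le> \<bar>\<theta>\<bar>" for \<phi>
  proof (rule Bochner_Integration.integrable_bound[OF integrable_exp_minus_cosh[of "z * cos \<theta>"]])
    show "(\<lambda>t. F (of_real t - \<i> * of_real \<phi>)) \<in> borel_measurable lborel"
      by (simp, intro borel_measurable_continuous_onI continuous_on_compose2[OF cont(1)[of UNIV]] continuous_intros) auto
  qed (use z c norm_F[OF that] in auto)
  have I_lim: "((\<lambda>T. I T (- \<i> * of_real \<phi>)) \<longlongrightarrow> (LINT t|lborel. F (of_real t - \<i> * of_real \<phi>))) at_top"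
    if "\<bar>\<phi>\<bar> \<le> \<bar>\<theta>\<bar>" for \<phi>
  proof -
    let ?f = "\<lambda>t. F (of_real t - \<i> * of_real \<phi>)"
    have "I T (- \<i> * of_real \<phi>) = (LINT t|lborel. indicator {-T..T} t *\<^sub>R ?f t)" for T
    proof -
      have "set_integrable lborel {-T..T} ?f"
        using integrable_mult_indicator[OF _ int[OF that], of "{-T..T}"] by (simp add: set_integrable_def)
      from set_borel_integral_eq_integral(2)[OF this] show ?thesis
        by (simp add: I_def set_lebesgue_integral_def)
    qed
    moreover have "((\<lambda>T. LINT t|lborel. indicator {-T..T} t *\<^sub>R ?f t) \<longlongrightarrow> (LINT t|lborel. ?f t)) at_top"
    proof (rule integral_dominated_convergence_at_top[where w = "\<lambda>t. norm (?f t)"])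
      show "AE t in lborel. ((\<lambda>T. indicator {-T..T} t *\<^sub>R ?f t) \<longlongrightarrow> ?f t) at_top"
      proof (rule AE_I2, rule tendsto_eventually)
        fix t :: real
        show "\<forall>\<^sub>F T in at_top. indicator {-T..T} t *\<^sub>R ?f t = ?f t"
          using eventually_ge_at_top[of "\<bar>t\<bar>"] by eventually_elim (auto simp: indicator_def)
      qed
    qed (use int[OF that] borel_measurable_integrable[OF int[OF that]] in \<open>auto simp: indicator_def\<close>)
    ultimately show ?thesis by simp
  qed
  have lim_0: "((\<lambda>T. I T (- \<i> * of_real \<theta>) - I T (- \<i> * of_real 0)) \<longlongrightarrow> 0) at_top"
  proof (rule Lim_null_comparison)
    show "\<forall>\<^sub>F T in at_top. norm (I T (- \<i> * of_real \<theta>) - I T (- \<i> * of_real 0)) \<le> 2 * exp (- (z * cos \<theta>) * cosh T) * \<bar>\<theta>\<bar>"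
      using eventually_ge_at_top[of 0] by eventually_elim (use I_diff in simp)
    have "((\<lambda>T. exp (- k * cosh T)) \<longlongrightarrow> 0) at_top" if "k > 0" for k :: real
      using that unfolding cosh_field_def by real_asymp
    from this[of "z * cos \<theta>"] show "((\<lambda>T. 2 * exp (- (z * cos \<theta>) * cosh T) * \<bar>\<theta>\<bar>) \<longlongrightarrow> 0) at_top"
      using z c by (intro tendsto_mult_left_zero tendsto_mult_right_zero) simp
  qed
  have "((\<lambda>T. I T (- \<i> * of_real \<theta>) - I T (- \<i> * of_real 0)) \<longlongrightarrow>
      (LINT t|lborel. F (of_real t - \<i> * of_real \<theta>)) - (LINT t|lborel. F (of_real t - \<i> * of_real 0))) at_top"
    by (intro tendsto_diff I_lim) auto
  from tendsto_unique[OF trivial_limit_at_top_linorder this lim_0]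
  have "(LINT t|lborel. F (of_real t - \<i> * of_real \<theta>)) = (LINT t|lborel. F (of_real t - \<i> * of_real 0))"
    by simp
  also have "\<dots> = (LINT t|lborel. complex_of_real (exp (- z * cosh t)))"
    by (simp add: F_def cosh_complex_of_real exp_of_real flip: of_real_mult of_real_minus)
  finally show ?thesis by (simp add: F_def)
qed

text \<open>With x = r sin \<theta> and y = r cos \<theta>,
  \<open>r * cosh (t - \<i> * \<theta>)\<close> equals y cosh t - i x sinh t. Positivity of y keeps
  \<bar>\<theta>\<bar> below pi/2, where the shift is valid.\<close>

lemma bessel_K_0_eq_integral:
  fixes x y b :: real
  assumes b: "b > 0" and y: "y > 0"
  shows "(LINT t|lborel. exp (Complex (- (b * y * cosh t)) (b * x * sinh t)))
       = complex_of_real (2 * bessel_K 0 (b * sqrt (x\<^sup>2 + y\<^sup>2)))"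
proof -
  define r where "r = sqrt (x\<^sup>2 + y\<^sup>2)"
  have r: "r > 0" unfolding r_def using y by (simp add: sum_power2_gt_zero_iff)
  define \<theta> where "\<theta> = arctan (x / y)"
  have \<theta>: "\<bar>\<theta>\<bar> < pi / 2" unfolding \<theta>_def using arctan_bounded[of "x / y"] by auto
  have "sqrt (1 + (x / y)\<^sup>2) = r / y"
  proof (rule real_sqrt_unique)
    show "(r / y)\<^sup>2 = 1 + (x / y)\<^sup>2"
      using y by (simp add: r_def power_divide add_divide_distrib)
  qed (use r y in simp)
  then have cs: "y = r * cos \<theta>" "x = r * sin \<theta>"
    unfolding \<theta>_def cos_arctan sin_arctan using r y by (simp_all add: field_simps)
  have "(LINT t|lborel. exp (Complex (- (b * y * cosh t)) (b * x * sinh t)))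
     = (LINT t|lborel. exp (- of_real (b * r) * cosh (of_real t - \<i> * of_real \<theta>)))"
    by (intro Bochner_Integration.integral_cong refl arg_cong[where f = exp])
       (simp add: cosh_diff_i complex_eq_iff cs)
  also have "\<dots> = of_real (LINT t|lborel. exp (- (b * r) * cosh t))"
    by (rule integral_exp_minus_cosh_shift) (use b r \<theta> in auto)
  also have "(LINT t|lborel. exp (- (b * r) * cosh t)) = 2 * bessel_K 0 (b * r)"
    using b r by (subst integral_exp_minus_cosh_eq_bessel_K[symmetric]) auto
  finally show ?thesis by (simp add: r_def)
qed

lemma integral_substitution_sinh:
  fixes f :: "real \<Rightarrow> complex"
  assumes A: "A > 0"
    and cont: "continuous_on UNIV f"
    and int: "integrable lborel f"
    and int': "integrable lborel (\<lambda>t. (A * cosh t) *\<^sub>R f (A * sinh t))"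
  shows "(LINT x|lborel. f x) = (LINT t|lborel. (A * cosh t) *\<^sub>R f (A * sinh t))"
proof -
  have "(LBINT x=-\<infinity>..\<infinity>. f x) = (LBINT t=-\<infinity>..\<infinity>. (A * cosh t) *\<^sub>R f (A * sinh t))"
  proof (rule interval_integral_substitution_integrable)
    show "DERIV (\<lambda>t. A * sinh t) t :> A * cosh t" for t
      by (auto intro!: derivative_eq_intros)
    show "isCont f (A * sinh t)" for t
      using cont by (simp add: continuous_on_eq_continuous_at)
    show "isCont (\<lambda>t. A * cosh t) t" for t
      by (intro continuous_intros)
    show "0 \<le> A * cosh t" for t
      using A by simp
    have "filterlim (\<lambda>t. A * sinh t) at_top at_top"
      using A unfolding sinh_field_def by real_asymp
    then show "((ereal \<circ> (\<lambda>t. A * sinh t) \<circ> real_of_ereal) \<longlongrightarrow> \<infinity>) (at_left \<infinity>)"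
      by (simp add: ereal_tendsto_simps)
    have "filterlim (\<lambda>t. A * sinh t) at_bot at_bot"
      using A unfolding sinh_field_def by real_asymp
    then show "((ereal \<circ> (\<lambda>t. A * sinh t) \<circ> real_of_ereal) \<longlongrightarrow> - \<infinity>) (at_right (- \<infinity>))"
      by (simp add: ereal_tendsto_simps)
  qed (use int int' in \<open>auto simp: set_integrable_def\<close>)
  then show ?thesis
    by (simp add: interval_lebesgue_integral_def set_lebesgue_integral_def)
qed

section \<open>Poisson summation over one row of image sources\<close>

lemma bessel_K_nonneg: "bessel_K 0 z \<ge> 0"
  unfolding bessel_K_def set_lebesgue_integral_def by (intro Bochner_Integration.integral_nonneg) simp

text \<open>The frequency \<open>\<surd>(\<alpha>\<^sub>m\<^sup>2 + \<beta>\<^sup>2)\<close>, with \<open>b\<close> in the place of \<open>\<beta>\<close>.\<close>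

definition chi :: "real \<Rightarrow> real \<Rightarrow> int \<Rightarrow> real" where
  "chi d b m = sqrt ((alpha d m)\<^sup>2 + b\<^sup>2)"

text \<open>Poisson summation is applied to the spectral side h: its Fourier coefficients are the
  Bessel values, which are nonnegative as \<open>poisson_summation_nonneg\<close> asks, and its
  values at the integers are the modes. Since y > 0, h and its derivative decay
  exponentially.\<close>

lemma has_sum_bessel_K_row:
  fixes x y b d :: real
  assumes d: "d > 0" and b: "b > 0" and y: "y > 0"
  shows "((\<lambda>m::int. complex_of_real (1 / (2 * pi) * bessel_K 0 (b * sqrt ((x - of_int m * d)\<^sup>2 + y\<^sup>2))))
           has_sum (\<Sum>\<^sub>\<infinity>j. of_real (exp (- chi d b j * y) / (2 * d * chi d b j)) * cis (alpha d j * x))) UNIV"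
proof -
  \<comment> \<open>This scaling makes integer k correspond to the frequency
    \<open>alpha d k\<close>.\<close>
  define s where "s = 2 * pi / d"
  have s: "s > 0" using d by (simp add: s_def)
  define X where "X = (\<lambda>k. sqrt ((s * k)\<^sup>2 + b\<^sup>2))"
  have X: "X k > 0" "X k \<ge> b" "X k \<ge> s * \<bar>k\<bar>" for k
  proof -
    show "X k > 0" using b by (simp add: X_def sum_power2_gt_zero_iff)
    show "X k \<ge> b" using b by (simp add: X_def real_le_rsqrt)
    show "X k \<ge> s * \<bar>k\<bar>" using s by (auto simp: X_def power_mult_distrib intro!: real_le_rsqrt)
  qed
  define X' where "X' = (\<lambda>k. s * (s * k / X k))"
  have X_deriv: "(X has_real_derivative X' k) (at k)" for k
    using X(1)[of k] unfolding X_def X'_def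
    by (auto intro!: derivative_eq_intros simp: field_simps power2_eq_square)
  have X'_bound: "\<bar>X' k\<bar> \<le> s" for k
    using X(1,3)[of k] s by (simp add: X'_def abs_mult pos_divide_le_eq mult_left_mono)
  define u where "u = (\<lambda>k. exp (- y * X k) / X k)"
  define u' where "u' = (\<lambda>k. u k * (- y * X' k - X' k / X k))"
  have u_deriv: "(u has_real_derivative u' k) (at k)" for k
    unfolding u_def u'_def using X(1)[of k]
    by (auto intro!: derivative_eq_intros X_deriv simp: field_simps)
  have u_pos: "u k > 0" for k using X(1)[of k] by (simp add: u_def)
  have u_bound: "u k \<le> 1 / b * exp (- (s * y) * \<bar>k\<bar>)" for k
  proof -
    have "exp (- y * X k) * inverse (X k) \<le> exp (- y * (s * \<bar>k\<bar>)) * inverse b"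
      using X[of k] y b by (intro mult_mono le_imp_inverse_le) auto
    then show ?thesis by (simp add: u_def field_simps)
  qed
  \<comment> \<open>The bracket in \<open>u'\<close> is the logarithmic derivative of u, bounded
    because \<bar>X'\<bar> \<le> s and X \<ge> b.\<close>
  have u'_bound: "\<bar>u' k\<bar> \<le> u k * (s * (y + 1 / b))" for k
  proof -
    have "\<bar>X' k / X k\<bar> \<le> s * inverse b"
      unfolding divide_inverse abs_mult using X'_bound[of k] X[of k] b s by (intro mult_mono) auto
    moreover have "\<bar>y * X' k\<bar> \<le> y * s"
      unfolding abs_mult using X'_bound[of k] y by simp
    ultimately have "\<bar>- y * X' k - X' k / X k\<bar> \<le> y * s + s * inverse b"
      by linarith
    also have "\<dots> = s * (y + 1 / b)"
      by (simp add: algebra_simps inverse_eq_divide)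
    finally have "\<bar>- y * X' k - X' k / X k\<bar> \<le> s * (y + 1 / b)" .
    then show ?thesis
      unfolding u'_def abs_mult using u_pos[of k] by simp
  qed
  define h where "h = (\<lambda>k. u k *\<^sub>R cis (s * x * k))"
  define h' where "h' = (\<lambda>k. u k *\<^sub>R ((s * x) *\<^sub>R (\<i> * cis (s * x * k))) + u' k *\<^sub>R cis (s * x * k))"
  have cis_deriv: "((\<lambda>k. cis (s * x * k)) has_vector_derivative (s * x) *\<^sub>R (\<i> * cis (s * x * k))) (at k)" for k
    unfolding cis_conv_exp
    by (auto intro!: derivative_eq_intros has_vector_derivative_real_field simp: scaleR_conv_of_real field_simps)
  have h_deriv: "(h has_vector_derivative h' k) (at k)" for k
    unfolding h_def h'_def by (intro has_vector_derivative_scaleR u_deriv cis_deriv)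
  \<comment> \<open>One constant for both h and h': the summand 1 serves h, and the other two serve
    the two product-rule terms of h'.\<close>
  define B where "B = 1 / b * (1 + s * \<bar>x\<bar> + s * (y + 1 / b))"
  have sy: "s * y > 0" using s y by simp
  have P: "1 / b > 0" "s * \<bar>x\<bar> \<ge> 0" "s * (y + 1 / b) \<ge> 0"
    using b s y by simp_all
  have le_B: "u k * r \<le> B * exp (- (s * y) * \<bar>k\<bar>)" if "r \<ge> 0" "r \<le> 1 + s * \<bar>x\<bar> + s * (y + 1 / b)" for k r
  proof -
    have "u k * r \<le> 1 / b * exp (- (s * y) * \<bar>k\<bar>) * (1 + s * \<bar>x\<bar> + s * (y + 1 / b))"
      using u_bound[of k] u_pos[of k] that P by (intro mult_mono) auto
    then show ?thesis by (simp add: B_def mult_ac)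
  qed
  have h_bound: "norm (h k) \<le> B * exp (- (s * y) * \<bar>k\<bar>)" for k
    using le_B[of 1 k] P u_pos[of k] by (simp add: h_def)
  have h'_bound: "norm (h' k) \<le> B * exp (- (s * y) * \<bar>k\<bar>)" for k
  proof -
    have "norm (h' k) \<le> u k * (s * \<bar>x\<bar>) + \<bar>u' k\<bar>"
      unfolding h'_def using u_pos[of k] s
      by (intro order_trans[OF norm_triangle_ineq]) (simp add: norm_mult abs_mult)
    also have "\<dots> \<le> u k * (s * \<bar>x\<bar> + s * (y + 1 / b))"
      using u'_bound[of k] by (simp add: distrib_left)
    also have "\<dots> \<le> B * exp (- (s * y) * \<bar>k\<bar>)"
      by (rule le_B) (use P in auto)
    finally show ?thesis .
  qed
  have h_cont: "continuous_on UNIV h"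
    by (intro continuous_at_imp_continuous_on ballI has_vector_derivative_continuous[OF h_deriv])
  have coeff: "(LINT k|lborel. h k * cis (- 2 * pi * of_int m * k))
      = of_real (d / pi * bessel_K 0 (b * sqrt ((x - of_int m * d)\<^sup>2 + y\<^sup>2)))" for m
  proof -
    define f where "f = (\<lambda>k. h k * cis (- 2 * pi * of_int m * k))"
    define E where "E = (\<lambda>t. exp (Complex (- (b * y * cosh t)) (b * (x - of_int m * d) * sinh t)))"
    have f_cont: "continuous_on UNIV f"
      unfolding f_def by (intro continuous_intros h_cont)
    have f_int: "integrable lborel f"
    proof (rule Bochner_Integration.integrable_bound)
      show "integrable lborel (\<lambda>k. B * exp (- (s * y) * \<bar>k\<bar>))"
        by (intro integrable_mult_right integrable_exp_minus_abs sy)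
      show "f \<in> borel_measurable lborel"
        using borel_measurable_continuous_onI[OF f_cont] by simp
      show "AE k in lborel. norm (f k) \<le> norm (B * exp (- (s * y) * \<bar>k\<bar>))"
        by (intro AE_I2) (use h_bound in \<open>auto simp: f_def norm_mult intro: order_trans[OF _ abs_ge_self]\<close>)
    qed
    have E_int: "integrable lborel E"
    proof (rule Bochner_Integration.integrable_bound)
      show "integrable lborel (\<lambda>t. exp (- (b * y) * cosh t))"
        using b y by (intro integrable_exp_minus_cosh) simp
      show "E \<in> borel_measurable lborel"
        unfolding E_def Complex_eq by (simp, intro borel_measurable_continuous_onI continuous_intros)
    qed (simp add: E_def)
    \<comment> \<open>Under k = (b / s) sinh t the root X becomes b cosh t, so the Jacobian cancels
      the denominator of u and leaves 1 / s = d / (2 pi).\<close>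
    have subst: "(b / s * cosh t) *\<^sub>R f (b / s * sinh t) = of_real (d / (2 * pi)) * E t" for t
    proof -
      have "(b * sinh t)\<^sup>2 + b\<^sup>2 = (b * cosh t)\<^sup>2"
        by (simp add: power_mult_distrib cosh_square_eq algebra_simps)
      then have "X (b / s * sinh t) = b * cosh t"
        using s b by (simp add: X_def)
      then have "f (b / s * sinh t) = (exp (- y * (b * cosh t)) / (b * cosh t)) *\<^sub>R
          cis (b * (x - of_int m * d) * sinh t)"
        using s d by (simp add: f_def h_def u_def cis_mult) (simp add: s_def field_simps)
      moreover have "E t = exp (- y * (b * cosh t)) *\<^sub>R cis (b * (x - of_int m * d) * sinh t)"
        by (simp add: E_def exp_eq_polar mult_ac scaleR_conv_of_real)
      moreover have "cosh t > 0" by simp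
      ultimately show ?thesis
        using b d by (simp add: s_def scaleR_conv_of_real field_simps)
    qed
    have "(LINT k|lborel. f k) = (LINT t|lborel. (b / s * cosh t) *\<^sub>R f (b / s * sinh t))"
    proof (rule integral_substitution_sinh[OF _ f_cont f_int])
      show "integrable lborel (\<lambda>t. (b / s * cosh t) *\<^sub>R f (b / s * sinh t))"
        unfolding subst by (intro integrable_mult_right E_int)
    qed (use b s in simp)
    also have "\<dots> = of_real (d / (2 * pi)) * (LINT t|lborel. E t)"
      by (simp only: subst integral_mult_right_zero)
    also have "(LINT t|lborel. E t) = complex_of_real (2 * bessel_K 0 (b * sqrt ((x - of_int m * d)\<^sup>2 + y\<^sup>2)))"
      unfolding E_def by (rule bessel_K_0_eq_integral[OF b y])
    finally show ?thesis by (simp add: f_def)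
  qed
  have "((\<lambda>m. complex_of_real (d / pi * bessel_K 0 (b * sqrt ((x - of_int m * d)\<^sup>2 + y\<^sup>2))))
      has_sum (\<Sum>\<^sub>\<infinity>j. h (of_int j))) UNIV"
    by (rule poisson_summation_nonneg[OF sy h_deriv h_bound h'_bound coeff]) (use d bessel_K_nonneg in simp)
  \<comment> \<open>The factor 1 / (2 d) turns the coefficient d / pi into the 1 / (2 pi) of the
    kernel.\<close>
  then have "((\<lambda>m. complex_of_real (1 / (2 * d)) * complex_of_real (d / pi * bessel_K 0 (b * sqrt ((x - of_int m * d)\<^sup>2 + y\<^sup>2))))
      has_sum complex_of_real (1 / (2 * d)) * (\<Sum>\<^sub>\<infinity>j. h (of_int j))) UNIV"
    by (rule has_sum_cmult_right)
  moreover have "complex_of_real (1 / (2 * d)) * (\<Sum>\<^sub>\<infinity>j. h (of_int j))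
      = (\<Sum>\<^sub>\<infinity>j. of_real (exp (- chi d b j * y) / (2 * d * chi d b j)) * cis (alpha d j * x))"
    unfolding infsum_cmult_right'[symmetric]
  proof (rule infsum_cong)
    fix j :: int
    have "X (of_int j) = chi d b j" "s * x * of_int j = alpha d j * x"
      by (simp_all add: X_def chi_def alpha_def s_def)
    note eqs = this
    show "complex_of_real (1 / (2 * d)) * h (of_int j)
        = of_real (exp (- chi d b j * y) / (2 * d * chi d b j)) * cis (alpha d j * x)"
      unfolding h_def u_def eqs by (simp add: scaleR_conv_of_real mult_ac)
  qed
  ultimately show ?thesis using d by simp
qed

section \<open>Fourier modes of the north kernel\<close>

text \<open>The real and the complex family are summable together, one direction by taking
  \<open>Re\<close>; otherwise both infinite sums are 0 by default.\<close>

lemma infsum_complex_of_real: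
  "(\<Sum>\<^sub>\<infinity>x\<in>A. complex_of_real (f x)) = of_real (\<Sum>\<^sub>\<infinity>x\<in>A. f x)"
proof (rule infsum_bounded_linear_strong)
  show "(\<lambda>x. complex_of_real (f x)) summable_on A \<longleftrightarrow> f summable_on A"
    using summable_on_Re[of "\<lambda>x. complex_of_real (f x)" A] summable_on_of_real[of f A] by auto
qed (rule bounded_linear_of_real)

lemma has_sum_geometric_from_2:
  fixes w :: complex
  assumes "norm w < 1"
  shows "((\<lambda>n::int. w ^ nat n) has_sum (w\<^sup>2 / (1 - w))) {2..}"
proof -
  have "((\<lambda>k. w ^ k) has_sum (1 / (1 - w))) UNIV"
    by (rule norm_summable_imp_has_sum)
       (use assms geometric_sums[of w] summable_geometric[of "norm w"] in \<open>auto simp: norm_power\<close>)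
  then have "((\<lambda>k. w\<^sup>2 * w ^ k) has_sum (w\<^sup>2 * (1 / (1 - w)))) UNIV"
    by (rule has_sum_cmult_right)
  also have "?this \<longleftrightarrow> ((\<lambda>n::int. w ^ nat n) has_sum (w\<^sup>2 / (1 - w))) {2..}"
    by (rule has_sum_reindex_bij_witness[of _ "\<lambda>n. nat (n - 2)" "\<lambda>k. int k + 2"])
       (auto simp: nat_add_distrib power_add power2_eq_square mult.commute)
  finally show ?thesis .
qed

text \<open>At \<open>b = 0\<close> this is the conjugate of \<^const>\<open>Q\<close>.\<close>

definition mode_exponent :: "real \<Rightarrow> real \<Rightarrow> real \<Rightarrow> real \<Rightarrow> int \<Rightarrow> complex" where
  "mode_exponent d \<xi> \<eta> b m = Complex (chi d b m * \<eta>) (alpha d m * \<xi>)"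

text \<open>The Fourier coefficient in m after summation over the rows n \<ge> 2, with (u, v) the
  difference of target and source. For m \<noteq> 0 it stays regular at b = 0; the mode 0 does not
  and is split off later.\<close>

definition north_mode :: "real \<Rightarrow> real \<Rightarrow> real \<Rightarrow> real \<Rightarrow> real \<Rightarrow> real \<Rightarrow> int \<Rightarrow> complex" where
  "north_mode d \<xi> \<eta> u v b m =
     of_real (exp (chi d b m * v) / (2 * d * chi d b m)) * cis (alpha d m * u)
       * (exp (- 2 * mode_exponent d \<xi> \<eta> b m) / (1 - exp (- mode_exponent d \<xi> \<eta> b m)))"

lemma chi_ge: "chi d b m \<ge> \<bar>alpha d m\<bar>" "chi d b m \<ge> \<bar>b\<bar>"
  unfolding chi_def by (auto intro!: real_le_rsqrt)

text \<open>Each row is replaced by its mode series; the double series converges absolutely, so the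
  sums can be exchanged, and for a fixed mode the sum over rows is geometric with ratio of norm
  below 1.\<close>

lemma K2_north_eq_infsum_modes:
  assumes d: "d > 0" and \<eta>: "\<eta> > 0" and b: "b > 0"
    and v: "\<bar>snd t - snd s\<bar> \<le> \<eta>"
  shows "complex_of_real (K2_north d \<xi> \<eta> b t s)
       = (\<Sum>\<^sub>\<infinity>m. north_mode d \<xi> \<eta> (fst t - fst s) (snd t - snd s) b m)"
proof -
  define u where "u = fst t - fst s"
  define v where "v = snd t - snd s"
  have v: "\<bar>v\<bar> \<le> \<eta>" using v by (simp add: v_def)
  define T where "T = (\<lambda>n j. of_real (exp (- chi d b j * (of_int n * \<eta> - v)) / (2 * d * chi d b j))
      * cis (alpha d j * (u - of_int n * \<xi>)))"
  have chi: "chi d b j > 0" for j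
    using chi_ge(2)[of b d j] b by simp
  have row: "(\<Sum>\<^sub>\<infinity>m. complex_of_real (1 / (2 * pi) * bessel_K 0 (b * norm (t - s - lattice_point d \<xi> \<eta> m n))))
      = (\<Sum>\<^sub>\<infinity>j. T n j)" if n: "n \<in> {2..}" for n
  proof -
    have "1 * \<eta> < real_of_int n * \<eta>" using n \<eta> by (intro mult_strict_right_mono) auto
    then have "of_int n * \<eta> - v > 0" using v by linarith
    from infsumI[OF has_sum_bessel_K_row[OF d b this, of "u - of_int n * \<xi>"]]
    have "(\<Sum>\<^sub>\<infinity>m. complex_of_real (1 / (2 * pi) * bessel_K 0 (b * sqrt ((u - of_int n * \<xi> - of_int m * d)\<^sup>2 + (of_int n * \<eta> - v)\<^sup>2))))
      = (\<Sum>\<^sub>\<infinity>j. T n j)"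
      by (simp add: T_def)
    moreover have "norm (t - s - lattice_point d \<xi> \<eta> m n)
        = sqrt ((u - of_int n * \<xi> - of_int m * d)\<^sup>2 + (of_int n * \<eta> - v)\<^sup>2)" for m
    proof -
      have "fst (t - s - lattice_point d \<xi> \<eta> m n) = u - of_int n * \<xi> - of_int m * d"
        "snd (t - s - lattice_point d \<xi> \<eta> m n) = - (of_int n * \<eta> - v)"
        by (simp_all add: lattice_point_def e1_def e2_def u_def v_def)
      then show ?thesis
        unfolding norm_prod_def real_norm_def power2_abs by (simp only: power2_minus)
    qed
    ultimately show ?thesis by simp
  qed
  define c where "c = b * \<eta> / 2"
  define c' where "c' = pi * \<eta> / d"
  have c: "c > 0" "c' > 0" using b \<eta> d by (simp_all add: c_def c'_def)
  \<comment> \<open>Since v \<le> \<eta>, the height n \<eta> - v is at least (n - 1) \<eta>.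
    Averaging the lower bounds b (n - 1) and \<bar>\<alpha>\<bar> for chi times (n - 1) gives decay
    in n and j at once, hence the halves in c and c'. The factor \<open>exp c\<close> compensates n
    - 1 against n.\<close>
  have T_bound: "norm (T n j) \<le> exp c / (2 * d * b) * exp (- c * \<bar>of_int n\<bar>) * exp (- c' * \<bar>of_int j\<bar>)"
    if n: "n \<in> {2..}" for n j
  proof -
    have n1: "real_of_int n - 1 \<ge> 1" using n by simp
    have "b * (of_int n - 1) \<le> chi d b j * (of_int n - 1)"
      using chi_ge(2)[of b d j] b n1 by (intro mult_right_mono) auto
    moreover have "\<bar>alpha d j\<bar> * 1 \<le> chi d b j * (of_int n - 1)"
      using chi_ge(1)[of d j b] chi[of j] n1 by (intro mult_mono) auto
    ultimately have "(b * (of_int n - 1) + \<bar>alpha d j\<bar>) / 2 \<le> chi d b j * (of_int n - 1)"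
      by simp
    then have "(b * (of_int n - 1) + \<bar>alpha d j\<bar>) / 2 * \<eta> \<le> chi d b j * (of_int n - 1) * \<eta>"
      using \<eta> by (intro mult_right_mono) auto
    also have "\<dots> = chi d b j * (of_int n * \<eta> - \<eta>)"
      by (simp add: algebra_simps)
    also have "\<dots> \<le> chi d b j * (of_int n * \<eta> - v)"
      using v chi[of j] by (intro mult_left_mono) auto
    also have "(b * (of_int n - 1) + \<bar>alpha d j\<bar>) / 2 * \<eta> = c * \<bar>of_int n\<bar> - c + c' * \<bar>of_int j\<bar>"
      using n d by (simp add: c_def c'_def alpha_def abs_mult field_simps)
    finally have "exp (- chi d b j * (of_int n * \<eta> - v)) \<le> exp (c + - c * \<bar>of_int n\<bar> + - c' * \<bar>of_int j\<bar>)"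
      by simp
    then have e: "exp (- chi d b j * (of_int n * \<eta> - v)) \<le> exp c * exp (- c * \<bar>of_int n\<bar>) * exp (- c' * \<bar>of_int j\<bar>)"
      by (simp only: exp_add)
    have "inverse (2 * d * chi d b j) \<le> inverse (2 * d * b)"
      using chi_ge(2)[of b d j] b d by (intro le_imp_inverse_le mult_left_mono) auto
    with e have bound: "exp (- chi d b j * (of_int n * \<eta> - v)) * inverse (2 * d * chi d b j)
        \<le> exp c * exp (- c * \<bar>of_int n\<bar>) * exp (- c' * \<bar>of_int j\<bar>) * inverse (2 * d * b)"
      using chi[of j] d by (intro mult_mono) auto
    have "norm (T n j) = exp (- chi d b j * (of_int n * \<eta> - v)) / (2 * d * chi d b j)"
      unfolding T_def norm_mult norm_of_real norm_cis using chi[of j] d by simp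
    with bound show ?thesis
      by (simp only: divide_inverse mult_ac)
  qed
  have "(\<lambda>(n, j). T n j) summable_on ({2..} \<times> UNIV)"
  proof (rule Infinite_Sum.abs_summable_summable, rule Infinite_Sum.abs_summable_on_comparison_test')
    let ?g = "\<lambda>(n::int, j::int). exp c / (2 * d * b) * exp (- c * \<bar>of_int n\<bar>) * exp (- c' * \<bar>of_int j\<bar>)"
    show "?g summable_on ({2..} \<times> UNIV)"
    proof (rule summable_on_SigmaI)
      let ?S = "\<Sum>\<^sub>\<infinity>j::int. exp (- c' * \<bar>of_int j\<bar>)"
      show "((\<lambda>j. ?g (n, j)) has_sum (exp c / (2 * d * b) * exp (- c * \<bar>of_int n\<bar>) * ?S)) UNIV" for n
        unfolding prod.case by (intro has_sum_cmult_right has_sum_infsum summable_on_exp_minus_abs_int c)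
      have "(\<lambda>n::int. exp (- c * \<bar>of_int n\<bar>)) summable_on {2..}"
        by (rule summable_on_subset_banach[OF summable_on_exp_minus_abs_int[OF c(1)]]) auto
      then show "(\<lambda>n. exp c / (2 * d * b) * exp (- c * \<bar>of_int n\<bar>) * ?S) summable_on {2..}"
        by (intro summable_on_cmult_left summable_on_cmult_right)
    qed (use d b in auto)
    show "norm (case p of (n, j) \<Rightarrow> T n j) \<le> ?g p" if "p \<in> {2..} \<times> UNIV" for p
      using that T_bound by (cases p) auto
  qed
  note summable = this
  have col: "(\<Sum>\<^sub>\<infinity>n\<in>{2..}. T n j) = north_mode d \<xi> \<eta> u v b j" for j
  proof -
    define E where "E = of_real (exp (chi d b j * v) / (2 * d * chi d b j)) * cis (alpha d j * u)"
    define w where "w = exp (- mode_exponent d \<xi> \<eta> b j)"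
    have w: "norm w < 1"
      using chi[of j] \<eta> by (simp add: w_def mode_exponent_def)
    have "T n j = E * w ^ nat n" if "n \<in> {2..}" for n
    proof -
      have "w ^ nat n = exp (of_int n * - mode_exponent d \<xi> \<eta> b j)"
        unfolding w_def using that exp_of_nat_mult[of "nat n" "- mode_exponent d \<xi> \<eta> b j"] by simp
      also have "of_int n * - mode_exponent d \<xi> \<eta> b j
          = of_real (- of_int n * chi d b j * \<eta>) + \<i> * of_real (- of_int n * alpha d j * \<xi>)"
        by (simp add: mode_exponent_def complex_eq_iff)
      also have "exp \<dots> = of_real (exp (- of_int n * chi d b j * \<eta>)) * cis (- of_int n * alpha d j * \<xi>)"
        by (simp only: exp_add exp_of_real cis_conv_exp)
      finally have "E * w ^ nat n = of_real ((exp (chi d b j * v) * exp (- of_int n * chi d b j * \<eta>)) / (2 * d * chi d b j))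
          * (cis (alpha d j * u) * cis (- of_int n * alpha d j * \<xi>))"
        by (simp add: E_def)
      also have "\<dots> = T n j"
        unfolding T_def cis_mult exp_add[symmetric] by (simp add: algebra_simps)
      finally show ?thesis by simp
    qed
    then have "(\<Sum>\<^sub>\<infinity>n\<in>{2..}. T n j) = (\<Sum>\<^sub>\<infinity>n\<in>{2::int..}. E * w ^ nat n)"
      by (intro infsum_cong) auto
    also have "\<dots> = E * (w\<^sup>2 / (1 - w))"
      by (intro infsumI has_sum_cmult_right has_sum_geometric_from_2 w)
    also have "w\<^sup>2 = exp (- 2 * mode_exponent d \<xi> \<eta> b j)"
      by (simp add: w_def flip: exp_double)
    finally show ?thesis
      by (simp add: north_mode_def E_def w_def)
  qed
  have "complex_of_real (K2_north d \<xi> \<eta> b t s) = (\<Sum>\<^sub>\<infinity>n\<in>{2..}. \<Sum>\<^sub>\<infinity>j. T n j)"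
    unfolding K2_north_def infsum_complex_of_real[symmetric] by (intro infsum_cong row)
  also have "\<dots> = (\<Sum>\<^sub>\<infinity>j. \<Sum>\<^sub>\<infinity>n\<in>{2..}. T n j)"
    by (rule infsum_swap_banach[OF summable])
  also have "\<dots> = (\<Sum>\<^sub>\<infinity>j. north_mode d \<xi> \<eta> u v b j)"
    by (simp only: col)
  finally show ?thesis by (simp add: u_def v_def)
qed

text \<open>With x = chi, the exponent x v - 2 x \<eta> is at most - x \<eta>, because v \<le>
  \<eta>, and x \<ge> 2 pi \<bar>m\<bar> / d bounds both numerator and denominator. The bound does
  not involve b, so it is a majorant for the limit b to 0 and also estimates the tail at b =
  0.\<close>

lemma norm_north_mode_le:
  assumes d: "d > 0" and \<eta>: "\<eta> > 0" and v: "\<bar>v\<bar> \<le> \<eta>" and m: "m \<noteq> 0"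
  defines "c \<equiv> 2 * pi * \<eta> / d"
  shows "norm (north_mode d \<xi> \<eta> u v b m) \<le> exp (- c * \<bar>of_int m\<bar>) / (4 * pi * (1 - exp (- c)))"
proof -
  define x where "x = chi d b m"
  have am: "\<bar>alpha d m\<bar> = 2 * pi * \<bar>of_int m\<bar> / d"
    using d by (simp add: alpha_def abs_mult)
  have m1: "1 \<le> \<bar>real_of_int m\<bar>" using m by linarith
  have "2 * pi / d * 1 \<le> 2 * pi / d * \<bar>of_int m\<bar>"
    using m1 d by (intro mult_left_mono) auto
  then have x: "x \<ge> 2 * pi / d" "x \<ge> 2 * pi / d * \<bar>of_int m\<bar>"
    using chi_ge(1)[of d m b] unfolding am x_def by auto
  have d0: "2 * pi / d > 0" using d by simp
  have x0: "x > 0" using x(1) d0 by linarith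
  have c: "c > 0" using d \<eta> by (simp add: c_def)
  have xc: "c * \<bar>of_int m\<bar> \<le> x * \<eta>" "c \<le> x * \<eta>"
    using mult_right_mono[OF x(1), of \<eta>] mult_right_mono[OF x(2), of \<eta>] \<eta>
    by (simp_all add: c_def mult_ac)
  have "1 - exp (- c) \<le> 1 - exp (- x * \<eta>)"
    using xc by simp
  also have "\<dots> \<le> norm (1 - exp (- mode_exponent d \<xi> \<eta> b m))"
    using norm_triangle_ineq2[of 1 "exp (- mode_exponent d \<xi> \<eta> b m)"]
    by (simp add: mode_exponent_def x_def)
  finally have den: "1 - exp (- c) \<le> norm (1 - exp (- mode_exponent d \<xi> \<eta> b m))" .
  have c1: "1 - exp (- c) > 0" using c by simp
  have "x * v \<le> x * \<eta>" using v x0 by (intro mult_left_mono) auto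
  then have num: "exp (x * v) * exp (- 2 * (x * \<eta>)) \<le> exp (- c * \<bar>of_int m\<bar>)"
    using xc(1) by (simp flip: exp_add)
  have "2 * d * (2 * pi / d) \<le> 2 * d * x"
    using x(1) d by (intro mult_left_mono) auto
  then have x4: "4 * pi \<le> 2 * d * x" using d by simp
  have prod: "4 * pi * (1 - exp (- c)) \<le> 2 * d * x * norm (1 - exp (- mode_exponent d \<xi> \<eta> b m))"
    by (rule mult_mono[OF x4 den]) (use d x0 c1 in auto)
  have "norm (north_mode d \<xi> \<eta> u v b m)
      = exp (x * v) * exp (- 2 * (x * \<eta>)) / (2 * d * x * norm (1 - exp (- mode_exponent d \<xi> \<eta> b m)))"
    using d x0 by (simp add: north_mode_def norm_mult norm_divide mode_exponent_def flip: x_def)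
  also have "\<dots> \<le> exp (- c * \<bar>of_int m\<bar>) / (4 * pi * (1 - exp (- c)))"
    using c1 by (intro frac_le num prod) auto
  finally show ?thesis .
qed

lemma continuous_on_north_mode:
  assumes d: "d > 0" and \<eta>: "\<eta> > 0" and m: "m \<noteq> 0"
  shows "continuous_on UNIV (\<lambda>b. north_mode d \<xi> \<eta> u v b m)"
proof -
  have chi: "chi d b m > 0" for b
    by (rule less_le_trans[OF _ chi_ge(1)]) (use d m in \<open>simp add: alpha_def\<close>)
  have "exp (- mode_exponent d \<xi> \<eta> b m) \<noteq> 1" for b
  proof
    assume "exp (- mode_exponent d \<xi> \<eta> b m) = 1"
    then have "norm (exp (- mode_exponent d \<xi> \<eta> b m)) = 1" by simp
    then show False using chi[of b] \<eta> by (simp add: mode_exponent_def)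
  qed
  moreover have "continuous_on UNIV (\<lambda>b. chi d b m)"
    unfolding chi_def by (intro continuous_intros)
  ultimately show ?thesis
    unfolding north_mode_def mode_exponent_def Complex_eq using chi d
    by (intro continuous_intros) (auto simp: less_imp_neq[symmetric] Complex_eq mode_exponent_def)
qed

text \<open>Uniform convergence by the Weierstrass test. Continuity holds across b = 0, so the limit
  of the nonzero modes is simply their value there.\<close>

lemma continuous_on_infsum_north_mode:
  assumes d: "d > 0" and \<eta>: "\<eta> > 0" and v: "\<bar>v\<bar> \<le> \<eta>"
  shows "continuous_on UNIV (\<lambda>b. \<Sum>\<^sub>\<infinity>m\<in>-{0}. north_mode d \<xi> \<eta> u v b m)"
proof (rule uniform_limit_theorem)
  define c where "c = 2 * pi * \<eta> / d"
  have c: "c > 0" using d \<eta> by (simp add: c_def)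
  show "uniform_limit UNIV (\<lambda>F b. \<Sum>m\<in>F. north_mode d \<xi> \<eta> u v b m)
      (\<lambda>b. \<Sum>\<^sub>\<infinity>m\<in>-{0}. north_mode d \<xi> \<eta> u v b m) (finite_subsets_at_top (-{0}))"
  proof (rule Weierstrass_m_test_general)
    show "norm (north_mode d \<xi> \<eta> u v b m) \<le> exp (- c * \<bar>of_int m\<bar>) * (1 / (4 * pi * (1 - exp (- c))))"
      if "m \<in> -{0}" for m b
      using norm_north_mode_le[OF d \<eta> v] that by (simp add: c_def)
    show "(\<lambda>m::int. exp (- c * \<bar>of_int m\<bar>) * (1 / (4 * pi * (1 - exp (- c))))) summable_on (-{0})"
      by (intro summable_on_cmult_left summable_on_subset_banach[OF summable_on_exp_minus_abs_int[OF c]]) auto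
  qed
  show "\<forall>\<^sub>F F in finite_subsets_at_top (-{0}). continuous_on UNIV (\<lambda>b. \<Sum>m\<in>F. north_mode d \<xi> \<eta> u v b m)"
    by (rule eventually_finite_subsets_at_top_weakI)
       (intro continuous_on_sum continuous_on_north_mode d \<eta>, auto)
qed simp

lemma summable_on_north_mode:
  assumes d: "d > 0" and \<eta>: "\<eta> > 0" and v: "\<bar>v\<bar> \<le> \<eta>" and A: "0 \<notin> A"
  shows "(\<lambda>m. north_mode d \<xi> \<eta> u v b m) summable_on A"
proof (rule Infinite_Sum.abs_summable_summable, rule Infinite_Sum.abs_summable_on_comparison_test')
  define c where "c = 2 * pi * \<eta> / d"
  have c: "c > 0" using d \<eta> by (simp add: c_def)
  show "norm (north_mode d \<xi> \<eta> u v b m) \<le> exp (- c * \<bar>of_int m\<bar>) * (1 / (4 * pi * (1 - exp (- c))))"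
    if "m \<in> A" for m
    using norm_north_mode_le[OF d \<eta> v] that A by (cases "m = 0") (auto simp: c_def)
  show "(\<lambda>m::int. exp (- c * \<bar>of_int m\<bar>) * (1 / (4 * pi * (1 - exp (- c))))) summable_on A"
    by (intro summable_on_cmult_left summable_on_subset_banach[OF summable_on_exp_minus_abs_int[OF c]]) auto
qed

section \<open>The limit of the zeroth mode\<close>

lemma tendsto_exp_remainder_2:
  fixes a :: real
  shows "((\<lambda>b. (exp (b * a) - 1 - b * a) / b\<^sup>2) \<longlongrightarrow> a\<^sup>2 / 2) (at_right 0)"
proof -
  have "((\<lambda>b. (exp (b * a) - 1 - b * a) / b\<^sup>2) \<longlongrightarrow> a * a / 2) (at_right 0)"
  proof -
    consider "a = 0" | "a > 0" | "a < 0" by linarith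
    then show ?thesis
      by cases (simp, real_asymp+)
  qed
  then show ?thesis by (simp add: power2_eq_square)
qed

text \<open>The mode m = 0 in real form; it depends neither on the horizontal offset nor on
  \<xi>.\<close>

definition zero_mode :: "real \<Rightarrow> real \<Rightarrow> real \<Rightarrow> real \<Rightarrow> real" where
  "zero_mode d \<eta> b v = exp (b * v) / (2 * d * b) * (exp (- 2 * (b * \<eta>)) / (1 - exp (- (b * \<eta>))))"

lemma north_mode_0:
  assumes "b > 0"
  shows "north_mode d \<xi> \<eta> u v b 0 = of_real (zero_mode d \<eta> b v)"
proof -
  have "mode_exponent d \<xi> \<eta> b 0 = of_real (b * \<eta>)" "chi d b 0 = b" "alpha d 0 = 0"
    using assms by (simp_all add: mode_exponent_def chi_def alpha_def complex_eq_iff)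
  then show ?thesis
    by (simp add: north_mode_def zero_mode_def flip: exp_of_real)
qed

text \<open>Neutrality cancels the terms of order \<open>1/b\<^sup>2\<close> and \<open>1/b\<close>, so only the second-order remainder of
  the exponential survives.\<close>

lemma tendsto_zero_mode_sum:
  fixes y z d \<eta> :: real and y' q :: "'a \<Rightarrow> real"
  assumes d: "d > 0" and \<eta>: "\<eta> > 0" and neutral: "(\<Sum>j\<in>J. q j) = 0"
  shows "((\<lambda>b. \<Sum>j\<in>J. (zero_mode d \<eta> b (y - y' j) - zero_mode d \<eta> b (z - y' j)) * q j)
           \<longlongrightarrow> - (y - z) / (2 * d * \<eta>) * (\<Sum>j\<in>J. y' j * q j)) (at_right 0)"
proof -
  define r where "r = (\<lambda>b a :: real. (exp (b * a) - 1 - b * a) / b\<^sup>2)"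
  \<comment> \<open>The factor b removes the pole of the geometric sum. The zero mode is then
    \<open>\<phi> b / (2 * d)\<close> times \<open>exp (b * a) / b\<^sup>2\<close>, whose poles are
    split off by r.\<close>
  define \<phi> where "\<phi> = (\<lambda>b. b * exp (- 2 * (b * \<eta>)) / (1 - exp (- (b * \<eta>))))"
  have "(\<phi> \<longlongrightarrow> inverse \<eta>) (at_right 0)"
    unfolding \<phi>_def using \<eta> by real_asymp
  then have \<phi>: "(\<phi> \<longlongrightarrow> 1 / \<eta>) (at_right 0)"
    by (simp only: inverse_eq_divide)
  have "((\<lambda>b. \<phi> b / (2 * d) * (\<Sum>j\<in>J. (r b (y - y' j) - r b (z - y' j)) * q j))
      \<longlongrightarrow> 1 / \<eta> / (2 * d) * (\<Sum>j\<in>J. ((y - y' j)\<^sup>2 / 2 - (z - y' j)\<^sup>2 / 2) * q j)) (at_right 0)"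
    unfolding r_def using d by (intro tendsto_intros \<phi> tendsto_exp_remainder_2) auto
  also have "1 / \<eta> / (2 * d) * (\<Sum>j\<in>J. ((y - y' j)\<^sup>2 / 2 - (z - y' j)\<^sup>2 / 2) * q j)
      = - (y - z) / (2 * d * \<eta>) * (\<Sum>j\<in>J. y' j * q j)"
  proof -
    \<comment> \<open>The squares of the source heights cancel between the targets, and the squares
      of the target heights are constant in j and fall to neutrality; the cross term
      remains.\<close>
    have "(\<Sum>j\<in>J. ((y - y' j)\<^sup>2 / 2 - (z - y' j)\<^sup>2 / 2) * q j)
        = (\<Sum>j\<in>J. (y\<^sup>2 - z\<^sup>2) / 2 * q j - (y - z) * (y' j * q j))"
      by (rule sum.cong) (simp_all add: power2_eq_square field_simps)
    also have "\<dots> = (y\<^sup>2 - z\<^sup>2) / 2 * (\<Sum>j\<in>J. q j) - (y - z) * (\<Sum>j\<in>J. y' j * q j)"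
      by (simp only: sum_subtractf sum_distrib_left)
    finally show ?thesis using d \<eta> neutral by (simp add: field_simps)
  qed
  finally show ?thesis
  proof (rule Lim_transform_eventually)
    have "\<phi> b / (2 * d) * (\<Sum>j\<in>J. (r b (y - y' j) - r b (z - y' j)) * q j)
        = (\<Sum>j\<in>J. (zero_mode d \<eta> b (y - y' j) - zero_mode d \<eta> b (z - y' j)) * q j)" if b: "b > 0" for b
    proof -
      have Z: "zero_mode d \<eta> b a = \<phi> b / (2 * d) * (1 / b\<^sup>2 + a / b + r b a)" for a
      proof -
        have "1 / b\<^sup>2 + a / b + r b a = exp (b * a) / b\<^sup>2"
          using b by (simp add: r_def power2_eq_square field_simps)
        then show ?thesis
          using b by (simp add: zero_mode_def \<phi>_def power2_eq_square mult_ac)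
      qed
      \<comment> \<open>The pole 1/b^2 cancels between the two targets; the pole 1/b leaves (y - z)
        / b, which is the same for every source and so vanishes by neutrality.\<close>
      have "(\<Sum>j\<in>J. (zero_mode d \<eta> b (y - y' j) - zero_mode d \<eta> b (z - y' j)) * q j)
          = (\<Sum>j\<in>J. \<phi> b / (2 * d) * ((y - z) / b) * q j + \<phi> b / (2 * d) * ((r b (y - y' j) - r b (z - y' j)) * q j))"
        unfolding Z by (rule sum.cong) (simp_all add: algebra_simps add_divide_distrib diff_divide_distrib)
      also have "\<dots> = \<phi> b / (2 * d) * ((y - z) / b) * (\<Sum>j\<in>J. q j)
          + \<phi> b / (2 * d) * (\<Sum>j\<in>J. (r b (y - y' j) - r b (z - y' j)) * q j)"
        by (simp only: sum.distrib sum_distrib_left)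
      finally show ?thesis using neutral by simp
    qed
    then show "\<forall>\<^sub>F b in at_right 0. \<phi> b / (2 * d) * (\<Sum>j\<in>J. (r b (y - y' j) - r b (z - y' j)) * q j)
        = (\<Sum>j\<in>J. (zero_mode d \<eta> b (y - y' j) - zero_mode d \<eta> b (z - y' j)) * q j)"
      using eventually_at_right_less[of 0] by (auto elim: eventually_mono)
  qed
qed

section \<open>The truncated expansion\<close>

text \<open>Conjugating \<open>Q\<close> gives \<open>mode_exponent\<close> at b = 0, and 2 d
  \<bar>\<alpha>\<bar> = 4 pi \<bar>m\<bar> matches the prefactors. Thus the factorization
  reproduces every nonzero mode exactly, and truncation is the only error.\<close>

lemma LDR_mode:
  assumes d: "d > 0" and m: "m \<noteq> 0"
  shows "L_north d t l m * D_north d \<xi> \<eta> m m * R_north d s m j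
       = north_mode d \<xi> \<eta> (fst (t l) - fst (s j)) (snd (t l) - snd (s j)) 0 m"
proof -
  define a where "a = alpha d m"
  define W where "W = exp (- 2 * mode_exponent d \<xi> \<eta> 0 m) / (1 - exp (- mode_exponent d \<xi> \<eta> 0 m))"
  have chi: "chi d 0 m = \<bar>a\<bar>" by (simp add: chi_def a_def)
  have "cnj (Q d \<xi> \<eta> m) = mode_exponent d \<xi> \<eta> 0 m"
    by (simp add: Q_def mode_exponent_def chi a_def complex_eq_iff)
  then have "cnj (exp (- 2 * Q d \<xi> \<eta> m) / (1 - exp (- Q d \<xi> \<eta> m))) = W"
    by (simp add: W_def exp_cnj)
  moreover have "2 * d * \<bar>a\<bar> = 4 * pi * \<bar>of_int m\<bar>"
    using d by (simp add: a_def alpha_def abs_mult)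
  moreover have "D_north d \<xi> \<eta> m m = of_real (1 / (4 * pi * \<bar>of_int m\<bar>))
      * cnj (exp (- 2 * Q d \<xi> \<eta> m) / (1 - exp (- Q d \<xi> \<eta> m)))"
    unfolding D_north_def D_south_def using m by simp
  ultimately have D: "D_north d \<xi> \<eta> m m = of_real (1 / (2 * d * \<bar>a\<bar>)) * W"
    by (simp only:)
  have L: "L_north d t l m = of_real (exp (\<bar>a\<bar> * snd (t l))) * cis (a * fst (t l))"
    using m unfolding L_north_def a_def cis_conv_exp exp_of_real by simp
  have R: "R_north d s m j = of_real (exp (- \<bar>a\<bar> * snd (s j))) * cis (- a * fst (s j))"
    using m unfolding R_north_def a_def cis_conv_exp exp_of_real by simp
  have "L_north d t l m * D_north d \<xi> \<eta> m m * R_north d s m j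
      = of_real (exp (\<bar>a\<bar> * snd (t l)) * exp (- \<bar>a\<bar> * snd (s j)) / (2 * d * \<bar>a\<bar>))
        * (cis (a * fst (t l)) * cis (- a * fst (s j))) * W"
    unfolding L D R by simp
  also have "\<dots> = north_mode d \<xi> \<eta> (fst (t l) - fst (s j)) (snd (t l) - snd (s j)) 0 m"
    unfolding north_mode_def chi W_def a_def[symmetric] cis_mult exp_add[symmetric]
    by (simp add: algebra_simps)
  finally show ?thesis .
qed

text \<open>\<open>D_north\<close> is diagonal, so the product is a sum over modes. With M \<ge> 0
  the index 0 is in range, and its term is separated because it comes from the limit of the singular
  mode.\<close>

lemma LDR_north_eq:
  assumes d: "d > 0" and M: "M \<ge> 0"
  shows "LDR_north d \<xi> \<eta> M N s t q l
      = of_real (- snd (t l) / (2 * d * \<eta>) * (\<Sum>j=1..N. snd (s j) * q j))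
        + (\<Sum>j=1..N. (\<Sum>m\<in>{-M..M}-{0}. north_mode d \<xi> \<eta> (fst (t l) - fst (s j)) (snd (t l) - snd (s j)) 0 m) * of_real (q j))"
proof -
  have diag: "mat_vec {-M..M} (D_north d \<xi> \<eta>) f m = D_north d \<xi> \<eta> m m * f m" if "m \<in> {-M..M}" for f m
  proof -
    have "mat_vec {-M..M} (D_north d \<xi> \<eta>) f m = (\<Sum>k\<in>{-M..M}. if k = m then D_north d \<xi> \<eta> m m * f m else 0)"
      unfolding mat_vec_def by (rule sum.cong) (auto simp: D_north_def D_south_def)
    then show ?thesis using that by simp
  qed
  define F where "F = (\<lambda>m. L_north d t l m * (D_north d \<xi> \<eta> m m * (\<Sum>j=1..N. R_north d s m j * of_real (q j))))"
  have "LDR_north d \<xi> \<eta> M N s t q l = (\<Sum>m\<in>{-M..M}. F m)"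
    unfolding LDR_north_def mat_vec_def[of _ "L_north d t"] F_def
    by (rule sum.cong) (auto simp: diag, simp add: mat_vec_def)
  also have "\<dots> = F 0 + (\<Sum>m\<in>{-M..M}-{0}. F m)"
    by (rule sum.remove) (use M in auto)
  also have "F 0 = of_real (- snd (t l) / (2 * d * \<eta>) * (\<Sum>j=1..N. snd (s j) * q j))"
    by (simp add: F_def L_north_def R_north_def D_north_def D_south_def)
  also have "(\<Sum>m\<in>{-M..M}-{0}. F m) = (\<Sum>m\<in>{-M..M}-{0}. \<Sum>j=1..N.
      north_mode d \<xi> \<eta> (fst (t l) - fst (s j)) (snd (t l) - snd (s j)) 0 m * of_real (q j))"
    by (intro sum.cong refl) (simp add: F_def sum_distrib_left LDR_mode[OF d, symmetric] mult.assoc)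
  also have "\<dots> = (\<Sum>j=1..N. (\<Sum>m\<in>{-M..M}-{0}. north_mode d \<xi> \<eta> (fst (t l) - fst (s j)) (snd (t l) - snd (s j)) 0 m) * of_real (q j))"
    by (subst sum.swap) (simp add: sum_distrib_right)
  finally show ?thesis .
qed

text \<open>Moving both half lines inward by M maps the complement of the window onto the nonzero
  integers and extracts the factor \<open>exp (- c * M)\<close>.\<close>

lemma has_sum_exp_minus_abs_tail:
  fixes c :: real and M :: int
  assumes c: "c > 0" and M: "M \<ge> 0"
  shows "((\<lambda>m. exp (- c * \<bar>of_int m\<bar>)) has_sum (exp (- c * of_int M) * (\<Sum>\<^sub>\<infinity>k\<in>-{0::int}. exp (- c * \<bar>of_int k\<bar>)))) (-{-M..M})"
proof -
  have "((\<lambda>k. exp (- c * of_int M) * exp (- c * \<bar>of_int k\<bar>)) has_sum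
      (exp (- c * of_int M) * (\<Sum>\<^sub>\<infinity>k\<in>-{0::int}. exp (- c * \<bar>of_int k\<bar>)))) (-{0})"
    by (intro has_sum_cmult_right has_sum_infsum summable_on_subset_banach[OF summable_on_exp_minus_abs_int[OF c]]) auto
  also have "?this \<longleftrightarrow> ?thesis"
    by (rule has_sum_reindex_bij_witness[of _ "\<lambda>m. if m > 0 then m - M else m + M" "\<lambda>k. if k > 0 then k + M else k - M"])
       (use M in \<open>auto simp: abs_if algebra_simps simp flip: exp_add\<close>)
  finally show ?thesis .
qed

lemma norm_north_mode_tail_le:
  assumes d: "d > 0" and \<eta>: "\<eta> > 0" and v: "\<bar>v\<bar> \<le> \<eta>" and M: "M \<ge> 0"
  defines "c \<equiv> 2 * pi * \<eta> / d"
  shows "norm ((\<Sum>\<^sub>\<infinity>m\<in>-{0}. north_mode d \<xi> \<eta> u v b m) - (\<Sum>m\<in>{-M..M}-{0}. north_mode d \<xi> \<eta> u v b m))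
       \<le> exp (- c * of_int M) * (\<Sum>\<^sub>\<infinity>k\<in>-{0::int}. exp (- c * \<bar>of_int k\<bar>)) * (1 / (4 * pi * (1 - exp (- c))))"
proof -
  have c: "c > 0" using d \<eta> by (simp add: c_def)
  let ?f = "north_mode d \<xi> \<eta> u v b"
  have split: "-{0} = ({-M..M}-{0}) \<union> -{-M..M}" using M by auto
  have "infsum ?f (-{0}) = infsum ?f ({-M..M}-{0}) + infsum ?f (-{-M..M})"
    by (subst split, rule infsum_Un_disjoint) (auto intro!: summable_on_north_mode d \<eta> v simp: M)
  then have "infsum ?f (-{0}) - (\<Sum>m\<in>{-M..M}-{0}. ?f m) = infsum ?f (-{-M..M})"
    by simp
  moreover have "norm (infsum ?f (-{-M..M})) \<le> exp (- c * of_int M) * (\<Sum>\<^sub>\<infinity>k\<in>-{0::int}. exp (- c * \<bar>of_int k\<bar>)) * (1 / (4 * pi * (1 - exp (- c))))"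
  proof (rule norm_infsum_le)
    show "(?f has_sum infsum ?f (-{-M..M})) (-{-M..M})"
      using M by (intro has_sum_infsum summable_on_north_mode d \<eta> v) auto
    show "((\<lambda>m. exp (- c * \<bar>of_int m\<bar>) * (1 / (4 * pi * (1 - exp (- c))))) has_sum
        (exp (- c * of_int M) * (\<Sum>\<^sub>\<infinity>k\<in>-{0::int}. exp (- c * \<bar>of_int k\<bar>)) * (1 / (4 * pi * (1 - exp (- c)))))) (-{-M..M})"
      by (intro has_sum_cmult_left has_sum_exp_minus_abs_tail c M)
    show "norm (?f m) \<le> exp (- c * \<bar>of_int m\<bar>) * (1 / (4 * pi * (1 - exp (- c))))" if "m \<in> -{-M..M}" for m
      using norm_north_mode_le[OF d \<eta> v, of m] that M unfolding c_def by auto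
  qed
  ultimately show ?thesis by simp
qed

text \<open>M is the least integer with exp (- c M) \<le> 1 / A. The factor 1 - exp (- c) gained
  here cancels the denominator in the bound on the modes.\<close>

lemma truncation_bounds:
  assumes d: "d > 0" and \<eta>: "\<eta> > 0" and \<epsilon>: "0 < \<epsilon>" "\<epsilon> < 1"
  shows "truncation d \<eta> \<epsilon> \<ge> 0"
    and "exp (- (2 * pi * \<eta> / d) * of_int (truncation d \<eta> \<epsilon>)) \<le> (1 - exp (- (2 * pi * \<eta> / d))) * \<epsilon>"
proof -
  define c where "c = 2 * pi * \<eta> / d"
  define A where "A = 1 / (1 - exp (- c)) * (1 / \<epsilon>)"
  have c: "c > 0" using d \<eta> by (simp add: c_def)
  have e: "0 < 1 - exp (- c)" "1 - exp (- c) < 1" using c by simp_all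
  have A: "A > 0" using e \<epsilon> by (simp add: A_def)
  \<comment> \<open>This gives A \<ge> 1, so its logarithm, and with it the truncation order, is
    nonnegative.\<close>
  have "(1 - exp (- c)) * \<epsilon> < 1 * 1" using e \<epsilon> by (intro mult_strict_mono) auto
  then have A1: "A \<ge> 1" using e \<epsilon> by (simp add: A_def field_simps)
  have tr: "truncation d \<eta> \<epsilon> = \<lceil>1 / c * ln A\<rceil>"
    by (simp add: truncation_def A_def c_def)
  show "truncation d \<eta> \<epsilon> \<ge> 0"
    unfolding tr using A1 c by (simp add: le_ceiling_iff) (smt (verit) divide_nonneg_pos ln_ge_zero)
  have "1 / c * ln A \<le> of_int (truncation d \<eta> \<epsilon>)"
    unfolding tr by (rule le_of_int_ceiling)
  then have "ln A \<le> c * of_int (truncation d \<eta> \<epsilon>)"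
    using c by (simp add: field_simps)
  then have "exp (- c * of_int (truncation d \<eta> \<epsilon>)) \<le> exp (- ln A)" by simp
  also have "\<dots> = inverse A"
    using A by (simp add: exp_minus)
  also have "\<dots> = (1 - exp (- c)) * \<epsilon>"
    by (simp add: A_def)
  finally show "exp (- (2 * pi * \<eta> / d) * of_int (truncation d \<eta> \<epsilon>)) \<le> (1 - exp (- (2 * pi * \<eta> / d))) * \<epsilon>"
    by (simp add: c_def)
qed

lemma unit_cell_snd_diff:
  assumes "\<eta> > 0" and "p \<in> unit_cell d \<xi> \<eta>" and "p' \<in> unit_cell d \<xi> \<eta>"
  shows "\<bar>snd p - snd p'\<bar> \<le> \<eta>"
proof -
  have "\<bar>snd p\<bar> \<le> \<eta> / 2" if p: "p \<in> unit_cell d \<xi> \<eta>" for p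
  proof -
    obtain x1 x2 where "p = x1 *\<^sub>R e1 d + x2 *\<^sub>R e2 \<xi> \<eta>" "\<bar>x2\<bar> \<le> 1/2"
      using p unfolding unit_cell_def by (auto simp: abs_le_iff)
    moreover from this have "\<bar>x2\<bar> * \<eta> \<le> 1/2 * \<eta>"
      using assms(1) by (intro mult_right_mono) auto
    ultimately show ?thesis using assms(1) by (simp add: e1_def e2_def abs_mult)
  qed
  from this[OF assms(2)] this[OF assms(3)] show ?thesis by linarith
qed

section \<open>The limit of the potential difference and the truncation error\<close>

theorem corollary3:
  fixes d \<xi> \<eta> :: real
  assumes "d > 0" and "\<eta> > 0" and "d \<ge> sqrt (\<xi>\<^sup>2 + \<eta>\<^sup>2)"
  shows "\<exists>C::real. \<forall>(\<epsilon>::real) (NS::nat) (NT::nat)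
           (s :: nat \<Rightarrow> real \<times> real) (t :: nat \<Rightarrow> real \<times> real) (q :: nat \<Rightarrow> real).
           0 < \<epsilon> \<and> \<epsilon> < 1
           \<and> (\<forall>j\<in>{1..NS}. s j \<in> unit_cell d \<xi> \<eta>)
           \<and> (\<forall>l\<in>{1..NT}. t l \<in> unit_cell d \<xi> \<eta>)
           \<and> (\<Sum>j=1..NS. q j) = 0
           \<longrightarrow> (\<forall>l\<in>{1..NT}. \<forall>l'\<in>{1..NT}. \<exists>\<Delta>::real.
                 ((\<lambda>\<beta>. \<Sum>j=1..NS. (K2_north d \<xi> \<eta> \<beta> (t l) (s j) - K2_north d \<xi> \<eta> \<beta> (t l') (s j)) * q j)
                    \<longlongrightarrow> \<Delta>) (at_right 0)
                 \<and> cmod (of_real \<Delta>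
                     - (LDR_north d \<xi> \<eta> (truncation d \<eta> \<epsilon>) NS s t q l
                        - LDR_north d \<xi> \<eta> (truncation d \<eta> \<epsilon>) NS s t q l'))
                   \<le> C * \<epsilon> * (\<Sum>j=1..NS. \<bar>q j\<bar>))"
proof -
  note d = assms(1) and \<eta> = assms(2)
  define c where "c = 2 * pi * \<eta> / d"
  define S where "S = (\<Sum>\<^sub>\<infinity>k\<in>-{0::int}. exp (- c * \<bar>of_int k\<bar>))"
  have c: "c > 0" using d \<eta> by (simp add: c_def)
  have S: "S \<ge> 0" unfolding S_def by (rule infsum_nonneg) simp
  show ?thesis
  \<comment> \<open>Each of the two targets contributes a tail of at most \<epsilon> S / (4 pi) per
    unit charge.\<close>
  proof (rule exI[of _ "S / (2 * pi)"], intro allI impI ballI)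
    fix \<epsilon> :: real and NS NT :: nat and s t :: "nat \<Rightarrow> real \<times> real" and q :: "nat \<Rightarrow> real" and l l' :: nat
    assume asm: "0 < \<epsilon> \<and> \<epsilon> < 1 \<and> (\<forall>j\<in>{1..NS}. s j \<in> unit_cell d \<xi> \<eta>)
           \<and> (\<forall>l\<in>{1..NT}. t l \<in> unit_cell d \<xi> \<eta>) \<and> (\<Sum>j=1..NS. q j) = 0"
      and l: "l \<in> {1..NT}" and l': "l' \<in> {1..NT}"
    define M where "M = truncation d \<eta> \<epsilon>"
    have M: "M \<ge> 0" "exp (- c * of_int M) \<le> (1 - exp (- c)) * \<epsilon>"
      using truncation_bounds[OF d \<eta>, of \<epsilon>] asm by (simp_all add: M_def c_def)
    define f where "f = (\<lambda>i j. north_mode d \<xi> \<eta> (fst (t i) - fst (s j)) (snd (t i) - snd (s j)))"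
    define H where "H = (\<lambda>i j b. \<Sum>\<^sub>\<infinity>m\<in>-{0}. f i j b m)"
    have v: "\<bar>snd (t i) - snd (s j)\<bar> \<le> \<eta>" if "i \<in> {1..NT}" "j \<in> {1..NS}" for i j
      using unit_cell_snd_diff[OF \<eta>] asm that by blast
    \<comment> \<open>Only the mode 0 is singular as \<beta> tends to 0; H collects the rest and is
      continuous there.\<close>
    have K: "complex_of_real (K2_north d \<xi> \<eta> b (t i) (s j)) = of_real (zero_mode d \<eta> b (snd (t i) - snd (s j))) + H i j b"
      if "b > 0" "i \<in> {1..NT}" "j \<in> {1..NS}" for b i j
    proof -
      have "complex_of_real (K2_north d \<xi> \<eta> b (t i) (s j)) = infsum (f i j b) UNIV"
        unfolding f_def by (rule K2_north_eq_infsum_modes[OF d \<eta> that(1) v[OF that(2,3)]])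
      also have "UNIV = insert 0 (-{0::int})" by auto
      also have "infsum (f i j b) \<dots> = f i j b 0 + H i j b"
        unfolding H_def f_def
        by (rule infsum_insert) (auto intro!: summable_on_north_mode d \<eta> v that)
      finally show ?thesis by (simp add: f_def north_mode_0[OF that(1)])
    qed
    define Z where "Z = - (snd (t l) - snd (t l')) / (2 * d * \<eta>) * (\<Sum>j=1..NS. snd (s j) * q j)"
    define D where "D = (\<lambda>b. \<Sum>j=1..NS. (K2_north d \<xi> \<eta> b (t l) (s j) - K2_north d \<xi> \<eta> b (t l') (s j)) * q j)"
    define L where "L = of_real Z + (\<Sum>j=1..NS. (H l j 0 - H l' j 0) * of_real (q j))"
    have H_lim: "(H i j \<longlongrightarrow> H i j 0) (at_right 0)" if "i \<in> {1..NT}" "j \<in> {1..NS}" for i j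
    proof -
      have "continuous_on UNIV (H i j)"
        unfolding H_def f_def by (rule continuous_on_infsum_north_mode[OF d \<eta> v[OF that]])
      then show ?thesis
        unfolding continuous_on_def by (auto intro: tendsto_within_subset)
    qed
    have lim: "((\<lambda>b. complex_of_real (D b)) \<longlongrightarrow> L) (at_right 0)"
    proof (rule Lim_transform_eventually)
      show "((\<lambda>b. of_real (\<Sum>j=1..NS. (zero_mode d \<eta> b (snd (t l) - snd (s j)) - zero_mode d \<eta> b (snd (t l') - snd (s j))) * q j)
          + (\<Sum>j=1..NS. (H l j b - H l' j b) * of_real (q j))) \<longlongrightarrow> L) (at_right 0)"
        unfolding L_def Z_def using asm l l'
        by (intro tendsto_add tendsto_of_real tendsto_zero_mode_sum tendsto_sum tendsto_mult tendsto_diff H_lim tendsto_const d \<eta>) auto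
      have "complex_of_real (\<Sum>j=1..NS. (zero_mode d \<eta> b (snd (t l) - snd (s j)) - zero_mode d \<eta> b (snd (t l') - snd (s j))) * q j)
          + (\<Sum>j=1..NS. (H l j b - H l' j b) * of_real (q j)) = of_real (D b)" if "b > 0" for b
        unfolding D_def of_real_sum sum.distrib[symmetric]
      proof (rule sum.cong)
        fix j assume j: "j \<in> {1..NS}"
        show "complex_of_real ((zero_mode d \<eta> b (snd (t l) - snd (s j)) - zero_mode d \<eta> b (snd (t l') - snd (s j))) * q j)
            + (H l j b - H l' j b) * of_real (q j)
            = of_real ((K2_north d \<xi> \<eta> b (t l) (s j) - K2_north d \<xi> \<eta> b (t l') (s j)) * q j)"
          unfolding of_real_mult of_real_diff K[OF that l j] K[OF that l' j]
          by (simp add: algebra_simps)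
      qed simp
      then show "\<forall>\<^sub>F b in at_right 0. complex_of_real (\<Sum>j=1..NS. (zero_mode d \<eta> b (snd (t l) - snd (s j)) - zero_mode d \<eta> b (snd (t l') - snd (s j))) * q j)
          + (\<Sum>j=1..NS. (H l j b - H l' j b) * of_real (q j)) = of_real (D b)"
        using eventually_at_right_less[of 0] by (auto elim: eventually_mono)
    qed
    have D_lim: "(D \<longlongrightarrow> Re L) (at_right 0)"
      using tendsto_Re[OF lim] by simp
    \<comment> \<open>L is defined through complex sums, but it is the limit of the real quantities
      D, so the required real limit is its real part.\<close>
    have L_real: "of_real (Re L) = L"
      by (rule tendsto_unique[OF _ tendsto_of_real[OF D_lim] lim]) simp
    have tail: "norm (H i j 0 - (\<Sum>m\<in>{-M..M}-{0}. f i j 0 m)) \<le> \<epsilon> * S / (4 * pi)"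
      if "i \<in> {1..NT}" "j \<in> {1..NS}" for i j
    proof -
      have "norm (H i j 0 - (\<Sum>m\<in>{-M..M}-{0}. f i j 0 m)) \<le> exp (- c * of_int M) * S * (1 / (4 * pi * (1 - exp (- c))))"
        unfolding H_def f_def S_def c_def by (rule norm_north_mode_tail_le[OF d \<eta> v[OF that] M(1)])
      \<comment> \<open>The choice of M enters here and makes 1 - exp (- c) cancel.\<close>
      also have "\<dots> \<le> (1 - exp (- c)) * \<epsilon> * S * (1 / (4 * pi * (1 - exp (- c))))"
        using M(2) S c by (intro mult_right_mono) auto
      also have "\<dots> = \<epsilon> * S / (4 * pi)"
        using c by (simp add: field_simps)
      finally show ?thesis .
    qed
    \<comment> \<open>The limit Z of the zero mode equals the difference of the two index-0 terms
      exactly, so only the tails of the nonzero modes survive.\<close>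
    have "L - (LDR_north d \<xi> \<eta> M NS s t q l - LDR_north d \<xi> \<eta> M NS s t q l')
        = (\<Sum>j=1..NS. ((H l j 0 - (\<Sum>m\<in>{-M..M}-{0}. f l j 0 m)) - (H l' j 0 - (\<Sum>m\<in>{-M..M}-{0}. f l' j 0 m))) * of_real (q j))"
    proof -
      have "Z = - snd (t l) / (2 * d * \<eta>) * (\<Sum>j=1..NS. snd (s j) * q j) - - snd (t l') / (2 * d * \<eta>) * (\<Sum>j=1..NS. snd (s j) * q j)"
        unfolding Z_def by (simp add: diff_divide_distrib left_diff_distrib)
      then show ?thesis
        unfolding LDR_north_eq[OF d M(1)] L_def
        by (simp add: f_def left_diff_distrib sum_subtractf)
    qed
    also have "norm \<dots> \<le> (\<Sum>j=1..NS. S / (2 * pi) * \<epsilon> * \<bar>q j\<bar>)"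
    proof (rule sum_norm_le)
      fix j assume j: "j \<in> {1..NS}"
      have "norm ((H l j 0 - (\<Sum>m\<in>{-M..M}-{0}. f l j 0 m)) - (H l' j 0 - (\<Sum>m\<in>{-M..M}-{0}. f l' j 0 m)))
          \<le> \<epsilon> * S / (4 * pi) + \<epsilon> * S / (4 * pi)"
        by (rule order_trans[OF norm_triangle_ineq4 add_mono[OF tail[OF l j] tail[OF l' j]]])
      also have "\<dots> = S / (2 * pi) * \<epsilon>" by (simp add: field_simps)
      finally show "norm (((H l j 0 - (\<Sum>m\<in>{-M..M}-{0}. f l j 0 m)) - (H l' j 0 - (\<Sum>m\<in>{-M..M}-{0}. f l' j 0 m))) * of_real (q j))
          \<le> S / (2 * pi) * \<epsilon> * \<bar>q j\<bar>"
        unfolding norm_mult norm_of_real by (rule mult_right_mono) simp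
    qed
    also have "\<dots> = S / (2 * pi) * \<epsilon> * (\<Sum>j=1..NS. \<bar>q j\<bar>)"
      by (rule sum_distrib_left[symmetric])
    finally show "\<exists>\<Delta>::real. ((\<lambda>\<beta>. \<Sum>j=1..NS. (K2_north d \<xi> \<eta> \<beta> (t l) (s j) - K2_north d \<xi> \<eta> \<beta> (t l') (s j)) * q j)
          \<longlongrightarrow> \<Delta>) (at_right 0)
        \<and> cmod (of_real \<Delta> - (LDR_north d \<xi> \<eta> (truncation d \<eta> \<epsilon>) NS s t q l - LDR_north d \<xi> \<eta> (truncation d \<eta> \<epsilon>) NS s t q l'))
          \<le> S / (2 * pi) * \<epsilon> * (\<Sum>j=1..NS. \<bar>q j\<bar>)"
      using D_lim L_real unfolding D_def M_def by (intro exI[of _ "Re L"]) simp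
  qed
qed

end
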